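(* For every $n\in\mathbb{N}$ with $10\mid n$, $m(n,11)=m(n,2^{5-1}-5)=\frac{2^5-5-\frac12}{5}\,n=5.3\,n$. Consequently $m(11)=5.3$.
   Context: For non-negative integers $n,m,a,b$ write $(n,m)\to(a,b)$ if for every $n$-element set $V$ and every family $\mathcal{F}\subseteq 2^{V}$ with $|\mathcal{F}|\ge m$ there is an $a$-element set $T\subseteq V$ with $|\mathcal{F}_{|T}|\ge b$, where $\mathcal{F}_{|T}=\{F\cap T: F\in\mathcal{F}\}$. For non-negative integers $n,s$, $m(n,s)$ denotes the maximum integer $m$ such that $(n,m)\to(n-1,m-s)$. For fixed $s$, $m(s)=\lim_{n\to\infty} m(n,s)/n$ (this limit exists). *)

theory Defs
  imports Complex_Main
begin

definition trace :: "nat set set \<Rightarrow> nat set \<Rightarrow> nat set set" where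
  "trace F T = (\<lambda>A. A \<inter> T) ` F"

text \<open>(n,m) -> (a,b): for every n-element set V and every family F of subsets of V
  with |F| >= m there is an a-element T subset of V with |F restricted to T| >= b.
  Ground sets are taken to be finite sets of naturals (no loss of generality,
  the property is invariant under bijections).\<close>
definition arrow :: "nat \<Rightarrow> nat \<Rightarrow> nat \<Rightarrow> nat \<Rightarrow> bool" where
  "arrow n m a b \<longleftrightarrow>
     (\<forall>V :: nat set. finite V \<and> card V = n \<longrightarrow>
        (\<forall>F. F \<subseteq> Pow V \<and> card F \<ge> m \<longrightarrow>
           (\<exists>T \<subseteq> V. card T = a \<and> card (trace F T) \<ge> b)))"

text \<open>m(n,s): the maximum m (among the non-vacuous range m \<le> 2^n) with
  (n,m) -> (n-1, m-s). For m < s the target m-s is truncated to 0, which agrees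
  with the trivially true condition for a negative target.\<close>
definition mns :: "nat \<Rightarrow> nat \<Rightarrow> nat" where
  "mns n s = Max {m. m \<le> 2 ^ n \<and> arrow n m (n - 1) (m - s)}"

end

theory Submission
  imports Defs
begin

text \<open>
  Call the loss of a family at a vertex the drop in size when the vertex is deleted. Down-compression
  keeps the size of a family and does not decrease any loss, so the arrow relation with \<open>s = 11\<close> amounts
  to bounding the size of a downset all of whose vertex degrees are at least 12.

  Every set of size \<open>k \<le> 4\<close> gives \<open>60 / k\<close> to each of its elements, and it suffices that the vertices
  receive 318 = 60 * 5.3 on average. A vertex that receives less has exactly four neighbours, and its
  link is either \<open>K\<^sub>4\<close> minus an edge with both triangles filled (it receives 310) or \<open>K\<^sub>4\<close> with one
  triangle filled (it receives 315). The deficits 8 and 3 are covered by neighbours with a surplus,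
  the amount depending on the number of sets that contain both vertices.

  The bound is attained by disjoint blocks of ten vertices: two copies of the subsets of size at most 3
  of a 5-set, each with one additional 4-set, joined by an edge between the two vertices outside the
  4-sets.
\<close>

subsection \<open>Compression\<close>

text \<open>Counts the pairs \<open>B\<close>, \<open>insert v B\<close> inside \<open>F\<close>,
  which become equal when \<open>v\<close> is deleted; \<open>card_trace_remove\<close> identifies
  it with the drop in size.\<close>

definition loss :: "'a set set \<Rightarrow> 'a \<Rightarrow> nat" where
  "loss F v = card {B \<in> F. v \<notin> B \<and> insert v B \<in> F}"

text \<open>The down-shift in direction \<open>x\<close>, given as a map on single sets, so that the
  compressed family is the image of \<open>F\<close> and injectivity gives its size.\<close>

definition compress :: "'a \<Rightarrow> 'a set set \<Rightarrow> 'a set \<Rightarrow> 'a set" where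
  "compress x F A = (if A - {x} \<in> F then A else A - {x})"

lemma inj_compress: "inj_on (compress x F) F"
proof (rule inj_onI)
  fix A B assume AB: "A \<in> F" "B \<in> F" "compress x F A = compress x F B"
  then have "A - {x} = B - {x}" by (auto simp: compress_def split: if_splits)
  moreover have "x \<in> A \<longleftrightarrow> x \<in> B"
  proof (cases "A - {x} \<in> F")
    case True
    with AB \<open>A - {x} = B - {x}\<close> show ?thesis by (simp add: compress_def)
  next
    case False
    then have "x \<in> A" using AB(1) by (metis Diff_empty Diff_insert0)
    moreover have "x \<in> B"
      using False AB(2) \<open>A - {x} = B - {x}\<close> by (metis Diff_empty Diff_insert0)
    ultimately show ?thesis by simp
  qed
  ultimately show "A = B" by blast
qed

text \<open>Compression acts separately on each pair of sets differing only in \<open>x\<close>: it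
  keeps the number of members in the pair and fills the lower place first.\<close>

lemma compress_image_iff:
  "A \<in> compress x F ` F \<longleftrightarrow>
     (if x \<in> A then A \<in> F \<and> A - {x} \<in> F else A \<in> F \<or> insert x A \<in> F)"
proof (cases "x \<in> A")
  case True
  have "A \<in> F \<and> A - {x} \<in> F" if "A \<in> compress x F ` F"
  proof -
    obtain B where "B \<in> F" "A = compress x F B" using \<open>A \<in> compress x F ` F\<close> by (rule imageE)
    then show ?thesis using True by (cases "B - {x} \<in> F") (simp_all add: compress_def)
  qed
  moreover have "A \<in> compress x F ` F" if "A \<in> F" "A - {x} \<in> F"
    using that by (metis compress_def imageI)
  ultimately show ?thesis using True by metis
next
  case False
  then have "compress x F A = A" by (simp add: compress_def)
  then have "A \<in> compress x F ` F" if "A \<in> F" using that by (metis imageI)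
  moreover have "A \<in> compress x F ` F" if "A \<notin> F" "insert x A \<in> F"
  proof -
    have "compress x F (insert x A) = A" using that False by (simp add: compress_def)
    then show ?thesis using that by (metis imageI)
  qed
  moreover have "A \<in> F \<or> insert x A \<in> F" if "A \<in> compress x F ` F"
  proof -
    obtain B where "B \<in> F" "A = compress x F B" using \<open>A \<in> compress x F ` F\<close> by (rule imageE)
    then have "A = B \<or> B = insert x A" by (auto simp: compress_def split: if_splits)
    then show ?thesis using \<open>B \<in> F\<close> by blast
  qed
  ultimately show ?thesis using False by metis
qed

text \<open>By an injection: a pair \<open>B\<close>, \<open>insert v B\<close> stays in place if
  removing \<open>x\<close> from both gives members of \<open>F\<close>, and otherwise moves down as
  a whole. For \<open>x = v\<close> every pair stays.\<close>

lemma loss_compress: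
  assumes "finite F"
  shows "loss F v \<le> loss (compress x F ` F) v"
proof -
  let ?G = "compress x F ` F"
  let ?E = "\<lambda>F. {B \<in> F. v \<notin> B \<and> insert v B \<in> F}"
  let ?f = "\<lambda>B. if B - {x} \<in> F \<and> insert v B - {x} \<in> F then B else B - {x}"
  \<comment> \<open>Hence a pair that moves with \<open>x \<noteq> v\<close> has \<open>x\<close> in
    \<open>B\<close>. As the test depends only on \<open>B - {x}\<close>, the pair can be recovered
    from its image.\<close>
  have moved: "B - {x} \<in> F \<and> insert v B - {x} \<in> F"
    if "B \<in> F" "insert v B \<in> F" "x \<notin> B" "x \<noteq> v" for B
  proof -
    have "B - {x} = B" "insert v B - {x} = insert v B" using that(3,4) by auto
    then show ?thesis using that by simp
  qed
  have inj: "inj_on ?f (?E F)"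
  proof (rule inj_onI)
    fix B C assume BC: "B \<in> ?E F" "C \<in> ?E F" "?f B = ?f C"
    then have e: "B - {x} = C - {x}" by (auto split: if_splits)
    have e2: "insert v B - {x} = insert v C - {x}" using e by auto
    show "B = C"
    proof (cases "B - {x} \<in> F \<and> insert v B - {x} \<in> F")
      case True
      with BC e e2 show ?thesis by simp
    next
      case False
      then have "x \<in> B \<or> x = v" using moved[of B] BC(1) by blast
      moreover have "x \<in> C \<or> x = v" using moved[of C] False e e2 BC(2) by (metis (no_types, lifting) mem_Collect_eq)
      ultimately show ?thesis using e BC(1,2) by blast
    qed
  qed
  have img: "?f ` ?E F \<subseteq> ?E ?G"
  proof
    fix C assume "C \<in> ?f ` ?E F"
    then obtain B where B: "B \<in> F" "v \<notin> B" "insert v B \<in> F" "C = ?f B" by auto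
    show "C \<in> ?E ?G"
    proof (cases "B - {x} \<in> F \<and> insert v B - {x} \<in> F")
      case True
      then have "C = B" using B(4) by simp
      with True B show ?thesis by (auto simp: compress_image_iff)
    next
      case False
      then have C: "C = B - {x}" using B(4) by (simp only: if_False)
      show ?thesis
      proof (cases "x = v")
        case True
        with False B show ?thesis by auto
      next
        case xv: False
        then have "x \<in> B" using False moved[of B] B by blast
        then have 1: "insert x C = B" "insert x (insert v C) = insert v B" "x \<notin> insert v C" "x \<notin> C" "v \<notin> C"
          using C xv B by auto
        show ?thesis using 1 B by (simp add: compress_image_iff)
      qed
    qed
  qed
  show ?thesis unfolding loss_def
    by (rule card_inj_on_le[OF inj img]) (use assms in auto)
qed

text \<open>Take a family of the same size, with losses at least \<open>k\<close>, whose total of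
  cardinalities is minimal. If some \<open>A - {x}\<close> were missing, compressing in direction
  \<open>x\<close> would lower the total.\<close>

lemma exists_downset:
  assumes "finite V" "F \<subseteq> Pow V" "\<And>v. v \<in> V \<Longrightarrow> k \<le> loss F v"
  obtains G where "G \<subseteq> Pow V" "card G = card F" "\<And>v. v \<in> V \<Longrightarrow> k \<le> loss G v"
    "\<And>A B. A \<in> G \<Longrightarrow> B \<subseteq> A \<Longrightarrow> B \<in> G"
proof -
  let ?P = "\<lambda>G. G \<subseteq> Pow V \<and> card G = card F \<and> (\<forall>v\<in>V. k \<le> loss G v)"
  define G where "G = arg_min (\<lambda>G. sum card G) ?P"
  have P: "?P G" unfolding G_def by (rule arg_min_natI[of _ F]) (use assms in auto)
  have mn: "sum card G \<le> sum card H" if "?P H" for H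
    unfolding G_def using that by (rule arg_min_nat_le)
  have finG: "finite G" using P assms(1) by (meson finite_Pow_iff finite_subset)
  have fin: "finite A" if "A \<in> G" for A using that P assms(1) by (meson PowD finite_subset subsetD)
  have one: "A - {x} \<in> G" if A: "A \<in> G" for A x
  proof (rule ccontr)
    assume n: "A - {x} \<notin> G"
    let ?H = "compress x G ` G"
    have "?P ?H"
    proof (intro conjI ballI)
      show "?H \<subseteq> Pow V" using P by (auto simp: compress_def split: if_splits)
      show "card ?H = card F" using P by (simp add: card_image inj_compress)
      fix v assume "v \<in> V"
      then have "k \<le> loss G v" using P by blast
      also have "\<dots> \<le> loss ?H v" by (rule loss_compress[OF finG])
      finally show "k \<le> loss ?H v" .
    qed
    then have "sum card G \<le> sum card ?H" by (rule mn)
    also have "\<dots> = (\<Sum>A\<in>G. card (compress x G A))"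
      by (simp add: sum.reindex inj_compress)
    also have "\<dots> < (\<Sum>A\<in>G. card A)"
    proof (rule sum_strict_mono_ex1[OF finG])
      show "\<forall>A\<in>G. card (compress x G A) \<le> card A"
        using fin by (auto simp: compress_def intro: card_mono)
      have "x \<in> A" using A n by (cases "x \<in> A") auto
      then have "card (A - {x}) < card A" using fin[OF A] by (intro card_Diff1_less)
      then have "card (compress x G A) < card A" using n by (simp add: compress_def)
      then show "\<exists>A\<in>G. card (compress x G A) < card A" using A by blast
    qed
    finally show False by simp
  qed
  have down: "B \<in> G" if "A \<in> G" "B \<subseteq> A" for A B
  proof -
    have "finite (A - B)" using fin[OF that(1)] by simp
    moreover have "A - C \<in> G" if "finite C" for C
      using that
    proof (induction C rule: finite_induct)
      case empty
      then show ?case using \<open>A \<in> G\<close> by simp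
    next
      case (insert x C)
      have "A - insert x C = (A - C) - {x}" by auto
      then show ?case using one[OF insert.IH, of x] by (simp del: Diff_insert)
    qed
    ultimately have "A - (A - B) \<in> G" by blast
    moreover have "A - (A - B) = B" using that by auto
    ultimately show ?thesis by simp
  qed
  show thesis using P down by (intro that[of G]) auto
qed

lemma loss_downset:
  assumes "\<And>A B. A \<in> F \<Longrightarrow> B \<subseteq> A \<Longrightarrow> B \<in> F"
  shows "loss F v = card {A \<in> F. v \<in> A}"
  unfolding loss_def
proof (rule bij_betw_same_card)
  have "{A \<in> F. v \<in> A} \<subseteq> insert v ` {B \<in> F. v \<notin> B \<and> insert v B \<in> F}"
  proof
    fix A assume A: "A \<in> {A \<in> F. v \<in> A}"
    then have "A - {v} \<in> F" "insert v (A - {v}) = A" using assms[of A "A - {v}"] by auto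
    then show "A \<in> insert v ` {B \<in> F. v \<notin> B \<and> insert v B \<in> F}" using A by (intro image_eqI[of _ _ "A - {v}"]) auto
  qed
  then show "bij_betw (insert v) {B \<in> F. v \<notin> B \<and> insert v B \<in> F} {A \<in> F. v \<in> A}"
    by (auto simp: bij_betw_def inj_on_def)
qed

section \<open>Traces on the complement of a vertex\<close>

lemma card_trace_remove:
  assumes "finite V" "F \<subseteq> Pow V" "v \<in> V"
  shows "card (trace F (V - {v})) + loss F v = card F"
proof -
  have fF: "finite F" using assms by (meson finite_Pow_iff finite_subset)
  \<comment> \<open>The upper halves \<open>insert v B\<close> of the merged pairs are discarded:
    the lower halves yield the same traces, and deleting \<open>v\<close> is injective on what is
    left.\<close>
  let ?E = "{B \<in> F. v \<notin> B \<and> insert v B \<in> F}"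
  have t: "trace F (V - {v}) = (\<lambda>A. A - {v}) ` (F - insert v ` ?E)"
  proof -
    have "trace F (V - {v}) = (\<lambda>A. A - {v}) ` F"
      unfolding trace_def by (rule image_cong) (use assms in auto)
    also have "\<dots> = (\<lambda>A. A - {v}) ` (F - insert v ` ?E)" (is "?L = ?R")
    proof
      show "?L \<subseteq> ?R"
      proof
        fix C assume "C \<in> ?L"
        then obtain A where A: "A \<in> F" "C = A - {v}" by auto
        show "C \<in> ?R"
        proof (cases "C \<in> F")
          case True
          then have "C \<in> F - insert v ` ?E" using A by auto
          moreover have "C = C - {v}" using A by auto
          ultimately show ?thesis by blast
        next
          case False
          then have "A \<in> F - insert v ` ?E" using A by auto
          then show ?thesis using A by blast
        qed
      qed
    qed auto
    finally show ?thesis .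
  qed
  have inj: "inj_on (\<lambda>A. A - {v}) (F - insert v ` ?E)"
  proof (rule inj_onI)
    fix A B assume h: "A \<in> F - insert v ` ?E" "B \<in> F - insert v ` ?E" "A - {v} = B - {v}"
    have key: "v \<notin> X \<or> v \<in> Y" if "X \<in> F - insert v ` ?E" "Y \<in> F" "X - {v} = Y - {v}" for X Y
    proof (rule ccontr)
      assume "\<not> ?thesis"
      then have "v \<in> X" "v \<notin> Y" by auto
      then have "X = insert v Y" using that(3) by auto
      then show False using that(1,2) \<open>v \<notin> Y\<close> by auto
    qed
    have "v \<in> A \<longleftrightarrow> v \<in> B" using key[of A B] key[of B A] h by auto
    then show "A = B" using h(3) by blast
  qed
  have "insert v ` ?E \<subseteq> F" by auto
  then have "card (F - insert v ` ?E) = card F - card (insert v ` ?E)"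
    "card (insert v ` ?E) \<le> card F"
    using fF by (auto intro!: card_Diff_subset card_mono intro: finite_subset)
  moreover have "card (insert v ` ?E) = loss F v"
    unfolding loss_def by (rule card_image) (auto simp: inj_on_def)
  ultimately show ?thesis using card_image[OF inj] t by simp
qed

subsection \<open>Downsets with all degrees at least 12\<close>

lemma sum_card_filter:
  assumes "finite X" "finite Y"
  shows "(\<Sum>x\<in>X. card {y \<in> Y. R x y}) = (\<Sum>y\<in>Y. card {x \<in> X. R x y})"
proof -
  have "(\<Sum>x\<in>X. card {y \<in> Y. R x y}) = (\<Sum>x\<in>X. \<Sum>y\<in>Y. if R x y then 1 else 0)"
    using assms(2) by (simp add: sum.If_cases Int_def)
  also have "\<dots> = (\<Sum>y\<in>Y. \<Sum>x\<in>X. if R x y then 1 else 0)" by (rule sum.swap)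
  also have "\<dots> = (\<Sum>y\<in>Y. card {x \<in> X. R x y})"
    using assms(1) by (simp add: sum.If_cases Int_def)
  finally show ?thesis .
qed

lemma card_3E:
  assumes "card A = 3"
  obtains a b c where "A = {a, b, c}" "a \<noteq> b" "a \<noteq> c" "b \<noteq> c"
  using assms by (auto simp: card_3_iff)

lemma card_2E:
  assumes "card A = 2"
  obtains a b where "A = {a, b}" "a \<noteq> b"
  using assms by (auto simp: card_2_iff)

lemma subset_3_cases:
  assumes "X \<subseteq> {a, b, c}"
  shows "X = {} \<or> X = {a} \<or> X = {b} \<or> X = {c} \<or> X = {a,b} \<or> X = {a,c} \<or> X = {b,c} \<or> X = {a,b,c}"
proof -
  have "X \<in> Pow {a, b, c}" using assms by simp
  then have "X \<in> {{}} \<union> {{c}} \<union> ({{b}} \<union> {{b,c}}) \<union> ({{a}} \<union> {{a,c}} \<union> ({{a,b}} \<union> {{a,b,c}}))"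
    by (simp only: Pow_insert Pow_empty image_insert image_empty image_Un Un_insert_left Un_insert_right Un_empty_right Un_empty_left)
  then show ?thesis
    by (simp only: Un_iff insert_iff empty_iff simp_thms) (elim disjE; simp only: simp_thms)
qed

text \<open>The split singles out \<open>d\<close> to suit \<open>star_typeB\<close>, where the
  three alternatives with a triple through \<open>d\<close> are impossible.\<close>

lemma subset_4_cases:
  assumes "X \<subseteq> {a, b, c, d}"
  shows "X \<subseteq> {a, b, c} \<or> X = {d} \<or> X = {a,d} \<or> X = {b,d} \<or> X = {c,d} \<or> {a,b,d} \<subseteq> X \<or> {a,c,d} \<subseteq> X \<or> {b,c,d} \<subseteq> X"
proof (cases "d \<in> X")
  case False
  then have "X \<subseteq> {a, b, c}" using assms by blast
  then show ?thesis by (rule disjI1)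
next
  case True
  then have X: "insert d (X - {d}) = X" by (rule insert_Diff)
  have "X - {d} \<subseteq> {a, b, c}" using assms by blast
  from subset_3_cases[OF this] consider "X - {d} = {}" | "X - {d} = {a}" | "X - {d} = {b}"
    | "X - {d} = {c}" | "{a,b} \<subseteq> X - {d}" | "{a,c} \<subseteq> X - {d}" | "{b,c} \<subseteq> X - {d}"
    by (elim disjE) simp_all
  then show ?thesis
  proof cases
    case 1
    with X have "X = {d}" by simp
    then show ?thesis by simp
  next
    case 2
    with X have "X = {a, d}" by (simp add: insert_commute)
    then show ?thesis by simp
  next
    case 3
    with X have "X = {b, d}" by (simp add: insert_commute)
    then show ?thesis by simp
  next
    case 4
    with X have "X = {c, d}" by (simp add: insert_commute)
    then show ?thesis by simp
  qed (use True in simp_all)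
qed

text \<open>The situation after compression: in a downset the loss at a vertex is its degree, so
  \<open>deg\<close> says that every deletion costs more than 11 sets.\<close>

locale dense_downset =
  fixes V :: "'a set" and F :: "'a set set"
  assumes finite_V: "finite V" and F_sub: "F \<subseteq> Pow V"
    and down: "\<And>A B. A \<in> F \<Longrightarrow> B \<subseteq> A \<Longrightarrow> B \<in> F"
    and deg: "\<And>v. v \<in> V \<Longrightarrow> 12 \<le> card {A \<in> F. v \<in> A}"
begin

definition S :: "'a \<Rightarrow> nat \<Rightarrow> 'a set set" where
  "S v k = {A \<in> F. v \<in> A \<and> card A = k}"

definition nbrs :: "'a \<Rightarrow> 'a set" where
  "nbrs v = {u. u \<noteq> v \<and> {v, u} \<in> F}"

definition codeg :: "'a \<Rightarrow> 'a \<Rightarrow> nat" where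
  "codeg u v = card {A \<in> F. u \<in> A \<and> v \<in> A}"

definition codegk :: "'a \<Rightarrow> 'a \<Rightarrow> nat \<Rightarrow> nat" where
  "codegk u v k = card {A \<in> F. u \<in> A \<and> v \<in> A \<and> card A = k}"

text \<open>The scale 60 is the least one making 1/2, 1/3, 1/4 and 5.3 integral; the constant term
  is the share from \<open>{v}\<close>.\<close>

definition W :: "'a \<Rightarrow> nat" where
  "W v = 60 + 30 * card (S v 2) + 20 * card (S v 3) + 15 * card (S v 4)"

definition bad :: "'a \<Rightarrow> bool" where
  "bad v \<longleftrightarrow> v \<in> V \<and> W v < 318"

lemma finite_F: "finite F"
  using finite_V F_sub by (meson finite_Pow_iff finite_subset)

lemma finite_mem: "A \<in> F \<Longrightarrow> finite A"
  using finite_V F_sub by (meson PowD finite_subset subsetD)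

lemma finite_S: "finite (S v k)"
  using finite_F by (auto simp: S_def)

lemma S_iff: "A \<in> S v k \<longleftrightarrow> A \<in> F \<and> v \<in> A \<and> card A = k"
  by (simp add: S_def)

lemma nbrs_sub: "nbrs v \<subseteq> V"
  using F_sub by (auto simp: nbrs_def)

lemma finite_nbrs: "finite (nbrs v)"
  using nbrs_sub finite_V finite_subset by blast

lemma nbrs_sym: "u \<in> nbrs v \<longleftrightarrow> v \<in> nbrs u"
  by (auto simp: nbrs_def insert_commute)

lemma not_nbrs_self: "v \<notin> nbrs v"
  by (simp add: nbrs_def)

lemma codegk_sym: "codegk u v k = codegk v u k"
  unfolding codegk_def by (rule arg_cong[of _ _ card]) auto

lemma mem_sub_nbrs: "A \<in> F \<Longrightarrow> v \<in> A \<Longrightarrow> A \<subseteq> insert v (nbrs v)"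
  using down by (auto simp: nbrs_def)

lemma sing_mem: "v \<in> V \<Longrightarrow> {v} \<in> F"
proof -
  assume "v \<in> V"
  then have "card {A \<in> F. v \<in> A} \<noteq> 0" using deg[of v] by simp
  then have "{A \<in> F. v \<in> A} \<noteq> {}" by (metis card.empty)
  then show ?thesis using down by blast
qed

lemma card_S1: "v \<in> V \<Longrightarrow> card (S v 1) = 1"
proof -
  assume "v \<in> V"
  then have "S v 1 = {{v}}" using sing_mem by (auto simp: S_def card_1_singleton_iff)
  then show ?thesis by simp
qed

lemma card_nbrs: "card (nbrs v) = card (S v 2)"
proof -
  have "S v 2 = (\<lambda>u. {v, u}) ` nbrs v"
    by (auto simp: S_def nbrs_def card_2_iff insert_commute)
  moreover have "inj_on (\<lambda>u. {v, u}) (nbrs v)"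
    by (auto simp: inj_on_def doubleton_eq_iff)
  ultimately show ?thesis by (simp add: card_image)
qed

lemma S_sub_image: "S v (Suc k) \<subseteq> insert v ` {X. X \<subseteq> nbrs v \<and> card X = k}"
proof
  fix A assume A: "A \<in> S v (Suc k)"
  then have "A - {v} \<subseteq> nbrs v" using mem_sub_nbrs[of A v] by (auto simp: S_def)
  moreover have "card (A - {v}) = k" using A by (simp add: S_def)
  moreover have "A = insert v (A - {v})" using A by (auto simp: S_def)
  ultimately show "A \<in> insert v ` {X. X \<subseteq> nbrs v \<and> card X = k}" by blast
qed

lemma inj_insert: "inj_on (insert v) {X. X \<subseteq> nbrs v \<and> P X}"
  using not_nbrs_self[of v] by (auto simp: inj_on_def)

lemma card_S_le: "card (S v (Suc k)) \<le> card (nbrs v) choose k"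
proof -
  have "card (S v (Suc k)) \<le> card (insert v ` {X. X \<subseteq> nbrs v \<and> card X = k})"
    using S_sub_image finite_nbrs by (intro card_mono) auto
  also have "\<dots> = card {X. X \<subseteq> nbrs v \<and> card X = k}"
    using inj_insert by (rule card_image)
  finally show ?thesis using n_subsets[OF finite_nbrs] by simp
qed

text \<open>A set through \<open>v\<close> is determined by its part in \<open>nbrs v\<close>, so
  three neighbours would allow at most 8 sets, short of 12.\<close>

lemma nbrs_ge4: assumes "v \<in> V" shows "4 \<le> card (nbrs v)"
proof (rule ccontr)
  assume n: "\<not> ?thesis"
  have "{A \<in> F. v \<in> A} \<subseteq> insert v ` Pow (nbrs v)"
  proof
    fix A assume A: "A \<in> {A \<in> F. v \<in> A}"
    then have "A - {v} \<in> Pow (nbrs v)" using mem_sub_nbrs[of A v] by auto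
    moreover have "A = insert v (A - {v})" using A by auto
    ultimately show "A \<in> insert v ` Pow (nbrs v)" by blast
  qed
  then have "card {A \<in> F. v \<in> A} \<le> card (Pow (nbrs v))"
    using finite_nbrs by (meson card_image_le card_mono finite_Pow_iff finite_imageI order_trans)
  then have "12 \<le> (2::nat) ^ card (nbrs v)" using deg[OF assms] finite_nbrs by (simp add: card_Pow)
  moreover have "(2::nat) ^ card (nbrs v) \<le> 2 ^ 3" using n by (intro power_increasing) auto
  ultimately show False by simp
qed

text \<open>One 4-set through \<open>v\<close> contains three triples through \<open>v\<close>; a
  vertex \<open>w\<close> of the second that is outside the first adds two triples through
  \<open>v\<close> and \<open>w\<close>.\<close>

lemma S4_two: assumes "2 \<le> card (S v 4)" shows "5 \<le> card (S v 3)"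
proof -
  obtain A B where A: "A \<in> S v 4" and B: "B \<in> S v 4" and ne: "A \<noteq> B"
  proof -
    obtain T where "T \<subseteq> S v 4" "card T = 2" using assms by (meson obtain_subset_with_card_n)
    then show thesis using that by (auto simp: card_2_iff)
  qed
  have "card (A - {v}) = 3" using A by (simp add: S_def)
  then obtain a b c where abc: "A - {v} = {a, b, c}" "a \<noteq> b" "a \<noteq> c" "b \<noteq> c" by (rule card_3E)
  have v: "v \<noteq> a" "v \<noteq> b" "v \<noteq> c" and Ae: "A = {v, a, b, c}" using A abc by (auto simp: S_def)
  have "\<not> B \<subseteq> A"
    using A B ne by (metis S_iff card_subset_eq finite_mem)
  then obtain w where w: "w \<in> B" "w \<notin> A" by auto
  have "w \<noteq> v" using w A by (auto simp: S_def)
  then have "card (B - {v} - {w}) = 2" using B w by (simp add: S_def)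
  then obtain p q where pq: "B - {v} - {w} = {p, q}" "p \<noteq> q" by (rule card_2E)
  have d: "w \<noteq> v" "w \<noteq> a" "w \<noteq> b" "w \<noteq> c" "v \<noteq> p" "v \<noteq> q" "w \<noteq> p" "w \<noteq> q"
    and Be: "B = {v, w, p, q}" using w Ae pq B by (auto simp: S_def)
  let ?P = "{{v,a,b}, {v,a,c}, {v,b,c}}" and ?Q = "{{v,w,p}, {v,w,q}}"
  let ?T = "?P \<union> ?Q"
  have "?T \<subseteq> S v 3"
  proof -
    have "X \<in> F" if "X \<subseteq> A \<or> X \<subseteq> B" for X using that A B down by (auto simp: S_iff)
    then have "?T \<subseteq> F" unfolding Ae Be by simp
    then show ?thesis using v d pq(2) abc(2-) by (simp add: S_iff)
  qed
  then have "card ?T \<le> card (S v 3)" by (intro card_mono finite_S)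
  moreover have "card ?T = 5"
  proof -
    have "card ?P = 3" using v abc(2-) by (simp add: card_insert_if set_eq_subset)
    moreover have "card ?Q = 2" using d pq(2) by (simp add: card_insert_if set_eq_subset)
    moreover have "?P \<inter> ?Q = {}"
    proof -
      have "w \<notin> X" if "X \<in> ?P" for X using that d by auto
      moreover have "w \<in> X" if "X \<in> ?Q" for X using that by auto
      ultimately show ?thesis by blast
    qed
    ultimately show ?thesis by (subst card_Un_disjoint) simp_all
  qed
  ultimately show ?thesis by simp
qed

text \<open>A set of size at least 5 through \<open>v\<close> would contain four 4-sets through
  \<open>v\<close>, so under the hypothesis only sizes 1 to 4 occur.\<close>

lemma card_star:
  assumes v: "v \<in> V" and "card (S v 4) \<le> 3"
  shows "card {A \<in> F. v \<in> A} = 1 + card (S v 2) + card (S v 3) + card (S v 4)"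
proof -
  have small: "card A \<le> 4" if A: "A \<in> F" "v \<in> A" for A
  proof (rule ccontr)
    assume "\<not> ?thesis"
    then have "4 \<le> card (A - {v})" using A finite_mem[OF A(1)] by simp
    then obtain B where B: "B \<subseteq> A - {v}" "card B = 4" by (meson obtain_subset_with_card_n)
    have "card {X. X \<subseteq> B \<and> card X = 3} = 4 choose 3"
      using n_subsets[of B 3] B by (metis card_eq_0_iff zero_neq_numeral)
    moreover have "inj_on (insert v) {X. X \<subseteq> B \<and> card X = 3}" using B by (auto simp: inj_on_def)
    moreover have "insert v ` {X. X \<subseteq> B \<and> card X = 3} \<subseteq> S v 4"
    proof safe
      fix X assume X: "X \<subseteq> B" "card X = 3"
      have "insert v X \<in> F" using A B X down[of A "insert v X"] by blast
      moreover have "v \<notin> X" "finite X" using X B by (auto intro: card_ge_0_finite)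
      ultimately show "insert v X \<in> S v 4" using X by (simp add: S_def)
    qed
    ultimately have "4 choose 3 \<le> card (S v 4)"
      using card_mono[OF finite_S] by (metis card_image)
    then show False using assms by (simp add: numeral_eq_Suc)
  qed
  have e: "{A \<in> F. v \<in> A} = (\<Union>k\<in>{1,2,3,4}. S v k)"
  proof -
    have "card A \<in> {1,2,3,4}" if A: "A \<in> F" "v \<in> A" for A
    proof -
      have "card A \<noteq> 0" using A finite_mem by auto
      then show ?thesis using small[OF A] by auto
    qed
    then show ?thesis by (fastforce simp: S_def)
  qed
  have "card (\<Union>k\<in>{1,2,3,4}. S v k) = (\<Sum>k\<in>{1,2,3,4}. card (S v k))"
    using finite_S by (intro card_UN_disjoint) (auto simp: S_def)
  then show ?thesis unfolding e using card_S1[OF v] by simp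
qed

lemma profile_size:
  assumes "v \<in> V" "card (S v 4) \<le> 3"
  shows "11 \<le> card (S v 2) + card (S v 3) + card (S v 4)"
  using deg[OF assms(1)] card_star[OF assms] by simp

lemma S2_ge4: "v \<in> V \<Longrightarrow> 4 \<le> card (S v 2)"
  using nbrs_ge4 by (simp add: card_nbrs)

lemma S3_le6: "card (S v 2) = 4 \<Longrightarrow> card (S v 3) \<le> 6"
  using card_S_le[of v 2] by (simp add: card_nbrs numeral_eq_Suc)

text \<open>With p, q, r sets of size 2, 3, 4 through \<open>v\<close>, badness means 30p + 20q +
  15r < 258, that is 318 - 60, while p is at least 4 and, for r at most 3, p + q + r is at least 11.
  For r = 0 the left side is at least 260; for r at least 3 it is at least 265, as
  \<open>S4_two\<close> gives five triples. The cases r = 1 and r = 2 leave q = 6 and q = 5, both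
  with p = 4.\<close>

lemma bad_profile:
  assumes "bad v"
  shows "card (S v 2) = 4 \<and> (card (S v 3) = 5 \<and> card (S v 4) = 2 \<or> card (S v 3) = 6 \<and> card (S v 4) = 1)"
proof -
  have v: "v \<in> V" and w: "30 * card (S v 2) + 20 * card (S v 3) + 15 * card (S v 4) < 258"
    using assms by (auto simp: bad_def W_def)
  note ge4 = S2_ge4[OF v] and size = profile_size[OF v]
  consider "card (S v 4) = 0" | "card (S v 4) = 1" | "card (S v 4) = 2" | "3 \<le> card (S v 4)"
    by linarith
  then show ?thesis
  proof cases
    case 1
    then show ?thesis using ge4 size w by linarith
  next
    case 2
    then have "card (S v 2) = 4" using ge4 size w by linarith
    then show ?thesis using 2 size S3_le6[of v] by linarith
  next
    case 3
    then have "5 \<le> card (S v 3)" using S4_two by simp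
    then show ?thesis using 3 ge4 size w by linarith
  next
    case 4
    then have "5 \<le> card (S v 3)" using S4_two[of v] by linarith
    then show ?thesis using 4 ge4 w by linarith
  qed
qed

subsection \<open>Vertices of small weight\<close>

text \<open>
  The links of the vertices of weight 310 and 315: \<open>K\<^sub>4\<close> minus the edge \<open>cd\<close> with both of its triangles
  filled, and \<open>K\<^sub>4\<close> with only the triangle \<open>abc\<close> filled.
\<close>

definition typeA :: "'a \<Rightarrow> 'a \<Rightarrow> 'a \<Rightarrow> 'a \<Rightarrow> 'a \<Rightarrow> bool" where
  "typeA v a b c d \<longleftrightarrow> distinct [v, a, b, c, d] \<and> nbrs v = {a, b, c, d} \<and>
     {v, a, b, c} \<in> F \<and> {v, a, b, d} \<in> F \<and> {v, c, d} \<notin> F"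

definition typeB :: "'a \<Rightarrow> 'a \<Rightarrow> 'a \<Rightarrow> 'a \<Rightarrow> 'a \<Rightarrow> bool" where
  "typeB v a b c d \<longleftrightarrow> distinct [v, a, b, c, d] \<and> nbrs v = {a, b, c, d} \<and>
     {v, a, b, c} \<in> F \<and> {v, a, d} \<in> F \<and> {v, b, d} \<in> F \<and> {v, c, d} \<in> F \<and>
     {v, a, b, d} \<notin> F \<and> {v, a, c, d} \<notin> F \<and> {v, b, c, d} \<notin> F"

text \<open>Symmetries of the link: they exchange the hubs \<open>a\<close>, \<open>b\<close> and
  the rim vertices \<open>c\<close>, \<open>d\<close>, and carry claims about \<open>a\<close> and
  \<open>c\<close> over to \<open>b\<close> and \<open>d\<close>.\<close>

lemma typeA_swap: "typeA v a b c d \<Longrightarrow> typeA v b a c d" "typeA v a b c d \<Longrightarrow> typeA v a b d c"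
proof -
  have "{b, a, c, d} = {a, b, c, d}" "{v, b, a, x} = {v, a, b, x}" "{a, b, d, c} = {a, b, c, d}"
    "{v, d, c} = {v, c, d}" for x by auto
  then show "typeA v a b c d \<Longrightarrow> typeA v b a c d" "typeA v a b c d \<Longrightarrow> typeA v a b d c"
    unfolding typeA_def by auto
qed

text \<open>Two transpositions moving \<open>a\<close> to \<open>b\<close> and to \<open>c\<close>:
  the base vertices \<open>a\<close>, \<open>b\<close>, \<open>c\<close> are equivalent, and the tip
  \<open>d\<close> is fixed.\<close>

lemma typeB_swap: "typeB v a b c d \<Longrightarrow> typeB v b a c d" "typeB v a b c d \<Longrightarrow> typeB v c b a d"
proof -
  have "{b, a, c, d} = {a, b, c, d}" "{v, b, a, x} = {v, a, b, x}" "{c, b, a, d} = {a, b, c, d}"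
    "{v, c, b, x} = {v, b, c, x}" "{v, c, a, x} = {v, a, c, x}" "{v, c, b, a} = {v, a, b, c}" for x by auto
  then show "typeB v a b c d \<Longrightarrow> typeB v b a c d" "typeB v a b c d \<Longrightarrow> typeB v c b a d"
    unfolding typeB_def by auto
qed

text \<open>As \<open>{v,c,d}\<close> is missing, the rest of a member through \<open>v\<close> lies
  in one of the triangles \<open>{a,b,c}\<close> and \<open>{a,b,d}\<close>, whose subsets are all
  present.\<close>

lemma star_typeA:
  assumes "typeA v a b c d"
  shows "{A \<in> F. v \<in> A} = {{v}, {v,a}, {v,b}, {v,c}, {v,d}, {v,a,b}, {v,a,c}, {v,a,d},
    {v,b,c}, {v,b,d}, {v,a,b,c}, {v,a,b,d}}" (is "_ = ?R")
proof
  note t = assms[unfolded typeA_def]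
  have "X \<in> F" if "X \<subseteq> {v,a,b,c} \<or> X \<subseteq> {v,a,b,d}" for X using that t down by blast
  then show "?R \<subseteq> {A \<in> F. v \<in> A}" by simp
  show "{A \<in> F. v \<in> A} \<subseteq> ?R"
  proof
    fix A assume A: "A \<in> {A \<in> F. v \<in> A}"
    then have "A \<subseteq> {v,a,b,c,d}" using mem_sub_nbrs[of A v] t by auto
    moreover have "\<not> {v,c,d} \<subseteq> A" using A t down by blast
    ultimately have "A - {v} \<subseteq> {a,b,c} \<or> A - {v} \<subseteq> {a,b,d}" using A by auto
    moreover have "A = insert v (A - {v})" using A by auto
    ultimately obtain X where X: "A = insert v X" "X \<subseteq> {a,b,c} \<or> X \<subseteq> {a,b,d}" by blast
    have "insert v X \<in> ?R" if "X \<subseteq> {a,b,c}" using subset_3_cases[OF that]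
      by (elim disjE) simp_all
    moreover have "insert v X \<in> ?R" if "X \<subseteq> {a,b,d}" using subset_3_cases[OF that]
      by (elim disjE) simp_all
    ultimately show "A \<in> ?R" unfolding X(1) using X(2) by (elim disjE)
  qed
qed

text \<open>Since \<open>d\<close> lies in no filled triangle of the link, the rest of a member
  through \<open>v\<close> is contained in \<open>{a,b,c}\<close> or is \<open>{d}\<close> or an
  edge at \<open>d\<close>.\<close>

lemma star_typeB:
  assumes "typeB v a b c d"
  shows "{A \<in> F. v \<in> A} = {{v}, {v,a}, {v,b}, {v,c}, {v,d}, {v,a,b}, {v,a,c}, {v,a,d},
    {v,b,c}, {v,b,d}, {v,c,d}, {v,a,b,c}}" (is "_ = ?R")
proof
  note t = assms[unfolded typeB_def]
  have "{v,a,b,c} \<in> F" "{v,a,d} \<in> F" "{v,b,d} \<in> F" "{v,c,d} \<in> F" using t by simp_all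
  then have "X \<in> F" if "X \<subseteq> {v,a,b,c} \<or> X \<subseteq> {v,a,d} \<or> X \<subseteq> {v,b,d} \<or> X \<subseteq> {v,c,d}" for X
    using that down by metis
  then show "?R \<subseteq> {A \<in> F. v \<in> A}" by simp
  show "{A \<in> F. v \<in> A} \<subseteq> ?R"
  proof
    fix A assume A: "A \<in> {A \<in> F. v \<in> A}"
    then have "A \<subseteq> {v,a,b,c,d}" using mem_sub_nbrs[of A v] t by auto
    then have sub: "A - {v} \<subseteq> {a,b,c,d}" by auto
    have n: "\<not> Y \<subseteq> A - {v}" if "insert v Y \<notin> F" for Y
    proof
      assume "Y \<subseteq> A - {v}"
      then have "insert v Y \<subseteq> A" using A by blast
      then show False using A down that by blast
    qed
    have "\<not> {a,b,d} \<subseteq> A - {v}" "\<not> {a,c,d} \<subseteq> A - {v}" "\<not> {b,c,d} \<subseteq> A - {v}"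
      by (rule n, use t in simp)+
    moreover have "A = insert v (A - {v})" using A by auto
    ultimately obtain X where X: "A = insert v X" "X \<subseteq> {a,b,c,d}"
      "\<not> {a,b,d} \<subseteq> X" "\<not> {a,c,d} \<subseteq> X" "\<not> {b,c,d} \<subseteq> X" using sub by blast
    then have "X \<subseteq> {a,b,c} \<or> X = {d} \<or> X = {a,d} \<or> X = {b,d} \<or> X = {c,d}"
      using subset_4_cases[OF X(2)] by metis
    moreover have "insert v X \<in> ?R" if "X \<subseteq> {a,b,c}" using subset_3_cases[OF that]
      by (elim disjE) simp_all
    ultimately show "A \<in> ?R" unfolding X(1) by (elim disjE) simp_all
  qed
qed

section \<open>Codegrees at a vertex of type A or B\<close>

lemma codeg_star: "codeg v u = card {A \<in> {A \<in> F. v \<in> A}. u \<in> A}"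
  unfolding codeg_def by (rule arg_cong[of _ _ card]) auto

lemma codegk_star: "codegk v u k = card {A \<in> {A \<in> F. v \<in> A}. u \<in> A \<and> card A = k}"
  unfolding codegk_def by (rule arg_cong[of _ _ card]) auto

text \<open>Turns each codegree into the evaluation of a filter on the explicit list of the twelve
  sets of a star.\<close>

lemma card_filter_list:
  "X = set xs \<Longrightarrow> distinct xs \<Longrightarrow> card {A \<in> X. P A} = length (filter P xs)"
  by (metis distinct_card distinct_filter set_filter)

lemma codeg_typeA:
  assumes "typeA v a b c d"
  shows "codeg v a = 6" "codegk v a 3 = 3" "codegk v a 4 = 2"
    "codeg v c = 4" "codegk v c 3 = 2" "codegk v c 4 = 1"
proof -
  let ?L = "[{v}, {v,a}, {v,b}, {v,c}, {v,d}, {v,a,b}, {v,a,c}, {v,a,d},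
    {v,b,c}, {v,b,d}, {v,a,b,c}, {v,a,b,d}]"
  have ne: "v \<noteq> a" "v \<noteq> b" "v \<noteq> c" "v \<noteq> d" "a \<noteq> b" "a \<noteq> c" "a \<noteq> d" "b \<noteq> c" "b \<noteq> d" "c \<noteq> d"
    using assms[unfolded typeA_def] by auto
  have "{A \<in> F. v \<in> A} = set ?L" unfolding star_typeA[OF assms] by (simp only: list.set)
  moreover have "distinct ?L" using ne by (simp add: set_eq_subset)
  ultimately have L: "card {A \<in> {A \<in> F. v \<in> A}. P A} = length (filter P ?L)" for P
    by (rule card_filter_list)
  show "codeg v a = 6" "codegk v a 3 = 3" "codegk v a 4 = 2"
    "codeg v c = 4" "codegk v c 3 = 2" "codegk v c 4 = 1"
    unfolding codeg_star codegk_star L using ne ne[symmetric] by simp_all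
qed

lemma codeg_typeB:
  assumes "typeB v a b c d"
  shows "codeg v a = 5" "codegk v a 3 = 3" "codegk v a 4 = 1"
    "codeg v d = 4" "codegk v d 3 = 3" "codegk v d 4 = 0"
proof -
  let ?L = "[{v}, {v,a}, {v,b}, {v,c}, {v,d}, {v,a,b}, {v,a,c}, {v,a,d},
    {v,b,c}, {v,b,d}, {v,c,d}, {v,a,b,c}]"
  have ne: "v \<noteq> a" "v \<noteq> b" "v \<noteq> c" "v \<noteq> d" "a \<noteq> b" "a \<noteq> c" "a \<noteq> d" "b \<noteq> c" "b \<noteq> d" "c \<noteq> d"
    using assms[unfolded typeB_def] by auto
  have "{A \<in> F. v \<in> A} = set ?L" unfolding star_typeB[OF assms] by (simp only: list.set)
  moreover have "distinct ?L" using ne by (simp add: set_eq_subset)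
  ultimately have L: "card {A \<in> {A \<in> F. v \<in> A}. P A} = length (filter P ?L)" for P
    by (rule card_filter_list)
  show "codeg v a = 5" "codegk v a 3 = 3" "codegk v a 4 = 1"
    "codeg v d = 4" "codegk v d 3 = 3" "codegk v d 4 = 0"
    unfolding codeg_star codegk_star L using ne ne[symmetric] by simp_all
qed

section \<open>Classification of the bad vertices\<close>

lemma card_4_2E:
  assumes "card N = 4" "{c, d} \<subseteq> N" "c \<noteq> d"
  obtains a b where "N = {a, b, c, d}" "distinct [a, b, c, d]"
proof -
  have "card (N - {c, d}) = 2" using assms by (subst card_Diff_subset) auto
  then obtain a b where "N - {c, d} = {a, b}" "a \<noteq> b" by (rule card_2E)
  moreover from this have "N = {a, b, c, d}" "a \<notin> {c, d}" "b \<notin> {c, d}" using assms by auto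
  ultimately show thesis using assms(3) by (intro that[of a b]) auto
qed

text \<open>Only five of the six pairs of neighbours span a triple with \<open>v\<close>. If
  \<open>{c,d}\<close> is the missing pair, a 4-set through \<open>v\<close> must be
  \<open>{v,a,b,c}\<close> or \<open>{v,a,b,d}\<close>.\<close>

lemma five_edges:
  assumes "card (S v 2) = 4" "card (S v 3) = 5"
  shows "card (S v 4) \<le> 2" "card (S v 4) = 2 \<Longrightarrow> \<exists>a b c d. typeA v a b c d"
proof -
  have N: "card (nbrs v) = 4" using assms by (simp add: card_nbrs)
  let ?P = "{X. X \<subseteq> nbrs v \<and> card X = 2}"
  have "card ?P = 4 choose 2" using n_subsets[OF finite_nbrs] N by simp
  then have "card (insert v ` ?P) = 6" using inj_insert by (subst card_image) (auto simp: numeral_eq_Suc)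
  then have "\<not> insert v ` ?P \<subseteq> S v 3"
    using assms(2) card_mono[OF finite_S, of "insert v ` ?P" v 3] by linarith
  then obtain X where X: "X \<subseteq> nbrs v" "card X = 2" "insert v X \<notin> S v 3" by auto
  obtain c d where cd: "X = {c, d}" "c \<noteq> d" using X(2) by (rule card_2E)
  obtain a b where ab: "nbrs v = {a, b, c, d}" "distinct [a, b, c, d]"
    using card_4_2E[OF N] X cd by metis
  have v: "v \<notin> {a, b, c, d}" using not_nbrs_self ab by metis
  have no: "{v, c, d} \<notin> F" using X cd v by (auto simp: S_def)
  have sub: "S v 4 \<subseteq> {{v,a,b,c}, {v,a,b,d}}"
  proof
    fix A assume A: "A \<in> S v 4"
    then have "A \<subseteq> {v,a,b,c,d}" using mem_sub_nbrs[of A v] ab by (auto simp: S_def)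
    moreover have "\<not> {v,c,d} \<subseteq> A" using A no down by (metis S_iff)
    ultimately have "A \<subseteq> {v,a,b,c} \<or> A \<subseteq> {v,a,b,d}" using A by (auto simp: S_def)
    moreover have "card {v,a,b,c} = card A" "card {v,a,b,d} = card A"
      using A ab v by (auto simp: S_def)
    ultimately show "A \<in> {{v,a,b,c}, {v,a,b,d}}"
      by (metis card_subset_eq finite.emptyI finite.insertI insertCI)
  qed
  have ne: "v \<noteq> a" "v \<noteq> b" "v \<noteq> c" "v \<noteq> d" "a \<noteq> b" "a \<noteq> c" "a \<noteq> d" "b \<noteq> c" "b \<noteq> d" "c \<noteq> d"
    using ab(2) v by auto
  have c2: "card {{v,a,b,c}, {v,a,b,d}} = 2" using ne by (simp add: set_eq_subset)
  then show "card (S v 4) \<le> 2" using sub card_mono by (metis finite.emptyI finite.insertI)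
  assume "card (S v 4) = 2"
  then have "S v 4 = {{v,a,b,c}, {v,a,b,d}}" using sub c2 by (intro card_subset_eq) auto
  then have "{v,a,b,c} \<in> F" "{v,a,b,d} \<in> F" using S_iff by blast+
  then have "typeA v a b c d" using ab(1) ne no unfolding typeA_def by simp
  then show "\<exists>a b c d. typeA v a b c d" by blast
qed

lemma six_edges_mem:
  assumes "card (S v 2) = 4" "card (S v 3) = 6" "x \<in> nbrs v" "y \<in> nbrs v" "x \<noteq> y"
  shows "{v, x, y} \<in> F"
proof -
  have N: "card (nbrs v) = 4" using assms by (simp add: card_nbrs)
  let ?P = "{X. X \<subseteq> nbrs v \<and> card X = 2}"
  have "card ?P = 4 choose 2" using n_subsets[OF finite_nbrs] N by simp
  then have "card (insert v ` ?P) = 6" using inj_insert by (subst card_image) (auto simp: numeral_eq_Suc)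
  moreover have "S v 3 \<subseteq> insert v ` ?P" using S_sub_image[of v 2] by simp
  ultimately have "S v 3 = insert v ` ?P" using assms finite_nbrs by (intro card_subset_eq) auto
  moreover have "{x, y} \<in> ?P" using assms by auto
  ultimately have "insert v {x, y} \<in> S v 3" by blast
  then show ?thesis by (simp add: S_def)
qed

text \<open>The unique 4-set through \<open>v\<close> supplies \<open>a\<close>, \<open>b\<close>,
  \<open>c\<close>, and the fourth neighbour is \<open>d\<close>; all pairs of neighbours span
  triples by \<open>six_edges_mem\<close>.\<close>

lemma six_edges:
  assumes "card (S v 2) = 4" "card (S v 3) = 6" "card (S v 4) = 1"
  shows "\<exists>a b c d. typeB v a b c d"
proof -
  have N: "card (nbrs v) = 4" using assms by (simp add: card_nbrs)
  obtain A where A: "S v 4 = {A}" using assms(3) by (auto simp: card_1_singleton_iff)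
  then have AS: "A \<in> F" "v \<in> A" "card A = 4" by (auto simp: S_def)
  then have "card (A - {v}) = 3" by simp
  then obtain a b c where abc: "A - {v} = {a, b, c}" "a \<noteq> b" "a \<noteq> c" "b \<noteq> c" by (rule card_3E)
  have sub: "{a, b, c} \<subseteq> nbrs v" using mem_sub_nbrs[OF AS(1,2)] abc(1) by auto
  have "card (nbrs v - {a, b, c}) = 1" using N sub abc(2-) by (subst card_Diff_subset) auto
  then obtain d where "nbrs v - {a, b, c} = {d}" by (auto simp: card_1_singleton_iff)
  then have d: "nbrs v = {a, b, c, d}" "d \<notin> {a, b, c}" using sub by auto
  have v: "v \<notin> {a, b, c, d}" using not_nbrs_self d(1) by metis
  have Ae: "A = {v, a, b, c}" using AS abc(1) by auto
  \<comment> \<open>Such a set would be a second 4-set through \<open>v\<close>, as \<open>A\<close>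
    avoids \<open>d\<close>.\<close>
  have "X \<notin> F" if "v \<in> X" "d \<in> X" "card X = 4" for X
  proof
    assume "X \<in> F"
    then have "X \<in> S v 4" using that by (simp add: S_def)
    then show False using that A Ae d(2) v by auto
  qed
  moreover have "card {v,a,b,d} = 4" "card {v,a,c,d} = 4" "card {v,b,c,d} = 4"
    using v d(2) abc(2-) by auto
  moreover have "{v,a,d} \<in> F" "{v,b,d} \<in> F" "{v,c,d} \<in> F"
    using d by (auto intro!: six_edges_mem[OF assms(1,2)])
  ultimately have "typeB v a b c d"
    using v d abc(2-) AS Ae unfolding typeB_def by auto
  then show ?thesis by blast
qed

lemma bad_cases:
  assumes "bad v"
  obtains a b c d where "typeA v a b c d" "card (S v 3) = 5" "card (S v 4) = 2"
  | a b c d where "typeB v a b c d" "card (S v 3) = 6" "card (S v 4) = 1"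
proof -
  consider "card (S v 2) = 4" "card (S v 3) = 5" "card (S v 4) = 2"
    | "card (S v 2) = 4" "card (S v 3) = 6" "card (S v 4) = 1"
    using bad_profile[OF assms] by blast
  then show thesis
  proof cases
    case 1
    then obtain a b c d where "typeA v a b c d" using five_edges(2) by blast
    then show thesis using 1 that(1) by blast
  next
    case 2
    then obtain a b c d where "typeB v a b c d" using six_edges by blast
    then show thesis using 2 that(2) by blast
  qed
qed

text \<open>In this order, \<open>g\<close> is a rim vertex of type A, a hub of type A, the tip of
  type B, or a base vertex of type B.\<close>

lemma bad_codeg:
  assumes "bad v" "g \<in> nbrs v"
  shows "(codegk v g 3, codegk v g 4, codeg v g) \<in> {(2,1,4), (3,2,6), (3,0,4), (3,1,5)}"
  using assms(1)
proof (cases rule: bad_cases)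
  case (1 a b c d)
  have "g \<in> {a, b, c, d}" using 1(1) assms(2) by (simp add: typeA_def)
  moreover note codeg_typeA[OF 1(1)] codeg_typeA[OF typeA_swap(1)[OF typeA_swap(2)[OF 1(1)]]]
  ultimately show ?thesis by auto
next
  case (2 a b c d)
  have "g \<in> {a, b, c, d}" using 2(1) assms(2) by (simp add: typeB_def)
  moreover note codeg_typeB[OF 2(1)] codeg_typeB[OF typeB_swap(1)[OF 2(1)]]
    codeg_typeB[OF typeB_swap(2)[OF 2(1)]]
  ultimately show ?thesis by auto
qed

subsection \<open>Discharging\<close>

lemma bad_nbrs_eq:
  assumes "bad u" "X \<subseteq> nbrs u" "card X = 4"
  shows "nbrs u = X"
  using assms bad_profile[OF assms(1)] card_subset_eq[OF finite_nbrs assms(2)] by (simp add: card_nbrs)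

text \<open>The two 4-sets already give \<open>a\<close> four neighbours, all that a bad vertex has.
  With \<open>{a,c,d}\<close> it would lie in six triples and two 4-sets, which is no bad
  profile.\<close>

lemma typeA_bad_hub:
  assumes t: "typeA v a b c d" and "bad a"
  shows "nbrs a = {v, b, c, d}" "{a, c, d} \<notin> F"
proof -
  have ne: "v \<noteq> a" "v \<noteq> b" "v \<noteq> c" "v \<noteq> d" "a \<noteq> b" "a \<noteq> c" "a \<noteq> d" "b \<noteq> c" "b \<noteq> d" "c \<noteq> d"
    using t unfolding typeA_def by auto
  have "{v, a, b, c} \<in> F" "{v, a, b, d} \<in> F" using t by (simp_all add: typeA_def)
  then have m: "X \<in> F" if "X \<subseteq> {v, a, b, c} \<or> X \<subseteq> {v, a, b, d}" for X using that down by metis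
  have "{v, b, c, d} \<subseteq> nbrs a" using ne by (simp add: nbrs_def m)
  moreover have "card {v, b, c, d} = 4" using ne by simp
  ultimately show "nbrs a = {v, b, c, d}" by (rule bad_nbrs_eq[OF assms(2)])
  show "{a, c, d} \<notin> F"
  proof
    assume acd: "{a, c, d} \<in> F"
    let ?L = "[{a,v,b}, {a,v,c}, {a,v,d}, {a,b,c}, {a,b,d}, {a,c,d}]"
    have "distinct ?L" using ne by (simp add: set_eq_subset)
    then have "card (set ?L) = 6" by (subst distinct_card) simp_all
    moreover have "set ?L \<subseteq> S a 3" using ne by (simp add: S_iff m acd)
    ultimately have "6 \<le> card (S a 3)" using card_mono[OF finite_S] by metis
    moreover have "card {{v,a,b,c}, {v,a,b,d}} = 2" using ne by (simp add: set_eq_subset)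
    moreover have "{{v,a,b,c}, {v,a,b,d}} \<subseteq> S a 4" using ne by (simp add: S_iff m)
    ultimately have "6 \<le> card (S a 3)" "2 \<le> card (S a 4)" using card_mono[OF finite_S] by metis+
    then show False using bad_profile[OF assms(2)] by simp
  qed
qed

text \<open>If \<open>a\<close> were bad too, let \<open>x\<close> be the fourth neighbour of
  \<open>c\<close> besides \<open>v\<close>, \<open>a\<close>, \<open>b\<close>. Neither
  \<open>{c,v,x}\<close> nor \<open>{c,a,x}\<close> can be present, so \<open>c\<close> lies in at
  most four triples, one too few.\<close>

lemma typeA_bad_rim:
  assumes t: "typeA v a b c d" and "bad c"
  shows "\<not> bad a"
proof
  assume "bad a"
  note hub = typeA_bad_hub[OF t \<open>bad a\<close>]
  have ne: "v \<noteq> a" "v \<noteq> b" "v \<noteq> c" "v \<noteq> d" "a \<noteq> b" "a \<noteq> c" "a \<noteq> d" "b \<noteq> c" "b \<noteq> d" "c \<noteq> d"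
    using t unfolding typeA_def by auto
  have "{v, a, b, c} \<in> F" "{v, c, d} \<notin> F" and nv: "nbrs v = {a, b, c, d}"
    using t by (simp_all add: typeA_def)
  then have m: "X \<in> F" if "X \<subseteq> {v, a, b, c}" for X using that down by metis
  have sub: "{v, a, b} \<subseteq> nbrs c" using ne ne[symmetric] by (simp add: nbrs_def m)
  have "card (nbrs c) = 4" using bad_profile[OF \<open>bad c\<close>] by (simp add: card_nbrs)
  then have "card (nbrs c - {v, a, b}) = 1" using sub ne by (subst card_Diff_subset) auto
  then obtain x where "nbrs c - {v, a, b} = {x}" by (auto simp: card_1_singleton_iff)
  then have x: "nbrs c = {v, a, b, x}" "x \<notin> {v, a, b}" using sub by auto
  then have xc: "x \<noteq> c" using not_nbrs_self[of c] by auto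
  \<comment> \<open>A triple with \<open>v\<close> makes \<open>x\<close> a neighbour of
    \<open>v\<close>, hence \<open>x = d\<close>, against the missing \<open>{v,c,d}\<close>. The
    argument for \<open>a\<close> is the same.\<close>
  have cvx: "{c, v, x} \<notin> F"
  proof
    assume "{c, v, x} \<in> F"
    then have "{v, x} \<in> F" by (rule down) simp
    then have "x \<in> nbrs v" using x(2) by (simp add: nbrs_def)
    then have "x = d" using nv x(2) xc by simp
    then show False using \<open>{c, v, x} \<in> F\<close> \<open>{v, c, d} \<notin> F\<close> by (simp add: insert_commute)
  qed
  have cax: "{c, a, x} \<notin> F"
  proof
    assume "{c, a, x} \<in> F"
    then have "{a, x} \<in> F" by (rule down) simp
    then have "x \<in> nbrs a" using x(2) by (simp add: nbrs_def)
    then have "x = d" using hub(1) x(2) xc by simp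
    then show False using \<open>{c, a, x} \<in> F\<close> hub(2) by (simp add: insert_commute)
  qed
  let ?L = "[{c,v,a}, {c,v,b}, {c,a,b}, {c,b,x}]"
  have "S c 3 \<subseteq> set ?L"
  proof
    fix A assume A: "A \<in> S c 3"
    then have Ac: "A = insert c (A - {c})" and card: "card (A - {c}) = 2" and F: "A \<in> F"
      and sub: "A - {c} \<subseteq> {v, a, b, x}"
      using mem_sub_nbrs[of A c] x(1) by (auto simp: S_iff)
    obtain p q where pq: "A - {c} = {p, q}" "p \<noteq> q" using card by (rule card_2E)
    then have A2: "A = {c, p, q}" using Ac by simp
    have "p \<in> {v, a, b, x}" "q \<in> {v, a, b, x}" using sub pq by auto
    then show "A \<in> set ?L" using F pq(2) cvx cax unfolding A2 by (auto simp: insert_commute)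
  qed
  then have "card (S c 3) \<le> length ?L" using card_mono[OF finite_set] card_length order_trans by blast
  then show False using bad_profile[OF \<open>bad c\<close>] by simp
qed

text \<open>When both hubs are bad, none of \<open>v\<close>, \<open>a\<close>, \<open>b\<close> has
  a neighbour outside \<open>{v,a,b,c,d}\<close> or forms a triple with \<open>{c,d}\<close>. A set
  through \<open>c\<close> thus lies in \<open>{v,a,b,c}\<close> or avoids \<open>v\<close>,
  \<open>a\<close>, \<open>b\<close>; two further neighbours of \<open>c\<close> would give too few
  sets.\<close>

lemma typeA_twins_rim:
  assumes t: "typeA v a b c d" and "bad a" "bad b"
  shows "6 \<le> card (S c 2)"
proof (rule ccontr)
  assume n: "\<not> ?thesis"
  note ha = typeA_bad_hub[OF t \<open>bad a\<close>] and hb = typeA_bad_hub[OF typeA_swap(1)[OF t] \<open>bad b\<close>]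
  have ne: "v \<noteq> a" "v \<noteq> b" "v \<noteq> c" "v \<noteq> d" "a \<noteq> b" "a \<noteq> c" "a \<noteq> d" "b \<noteq> c" "b \<noteq> d" "c \<noteq> d"
    using t unfolding typeA_def by auto
  have F: "{v, a, b, c} \<in> F" "{v, c, d} \<notin> F" and nv: "nbrs v = {a, b, c, d}"
    using t by (simp_all add: typeA_def)
  then have m: "X \<in> F" if "X \<subseteq> {v, a, b, c}" for X using that down by metis
  have sub: "{v, a, b} \<subseteq> nbrs c" using ne ne[symmetric] by (simp add: nbrs_def m)
  let ?R = "nbrs c - {v, a, b}"
  have "card ?R + 3 = card (nbrs c)"
    using sub ne card_mono[OF finite_nbrs sub] by (subst card_Diff_subset) auto
  then have R: "card ?R \<le> 2" using n by (simp add: card_nbrs)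
  have "{A \<in> F. c \<in> A} \<subseteq> insert c ` (Pow {v, a, b} \<union> Pow ?R)"
  proof
    fix A assume "A \<in> {A \<in> F. c \<in> A}"
    then have A: "A \<in> F" "c \<in> A" by auto
    have Ac: "A = insert c (A - {c})" using A by auto
    have s: "A - {c} \<subseteq> nbrs c" using mem_sub_nbrs[OF A] by auto
    have "A - {c} \<subseteq> {v, a, b} \<or> A - {c} \<subseteq> ?R"
    proof (cases "v \<in> A \<or> a \<in> A \<or> b \<in> A")
      case True
      then obtain u where u: "u \<in> A" "u \<in> {v, a, b}" by auto
      have nu: "nbrs u \<subseteq> {v, a, b, c, d}" and no: "{u, c, d} \<notin> F"
        using u(2) nv ha hb F(2) by auto
      have "A \<subseteq> {v, a, b, c, d}" using mem_sub_nbrs[OF A(1) u(1)] nu u(2) by blast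
      moreover have "\<not> {u, c, d} \<subseteq> A" using A(1) no down by blast
      then have "d \<notin> A" using u(1) A(2) by simp
      ultimately have "A - {c} \<subseteq> {v, a, b}" by blast
      then show ?thesis ..
    next
      case False
      then have "A - {c} \<subseteq> ?R" using s by blast
      then show ?thesis ..
    qed
    then have "A - {c} \<in> Pow {v, a, b} \<union> Pow ?R" by simp
    with Ac show "A \<in> insert c ` (Pow {v, a, b} \<union> Pow ?R)" by (rule image_eqI)
  qed
  then have "card {A \<in> F. c \<in> A} \<le> card (Pow {v, a, b} \<union> Pow ?R)"
    using finite_nbrs[of c] by (intro surj_card_le) simp_all
  \<comment> \<open>At most 8 + 4 - 1 = 11, since the empty set is common to both power
    sets.\<close>
  also have "card (Pow {v, a, b} \<union> Pow ?R) < 12"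
  proof -
    have "card (Pow {v, a, b} \<union> Pow ?R) + card (Pow {v, a, b} \<inter> Pow ?R)
      = card (Pow {v, a, b}) + card (Pow ?R)"
      using finite_nbrs by (intro card_Un_Int[symmetric]) auto
    moreover have "Pow {v, a, b} \<inter> Pow ?R = {{}}" by blast
    moreover have "card (Pow {v, a, b}) = 8" using ne by (subst card_Pow) auto
    moreover have "card (Pow ?R) \<le> 4"
      using power_increasing[OF R, of "2::nat"] finite_nbrs by (subst card_Pow) auto
    ultimately show ?thesis by simp
  qed
  moreover have "c \<in> V" using nv nbrs_sub by blast
  ultimately show False using deg by fastforce
qed

text \<open>A bad \<open>d\<close> has exactly the neighbours \<open>v\<close>, \<open>a\<close>,
  \<open>b\<close>, \<open>c\<close>. No 4-set contains \<open>v\<close> and \<open>d\<close>, so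
  \<open>d\<close> is of type B with tip \<open>v\<close> and \<open>{d,a,b,c}\<close> is present.
  Then \<open>a\<close> lies in six triples and two 4-sets and is not bad.\<close>

lemma typeB_bad_tip:
  assumes t: "typeB v a b c d" and "bad d"
  shows "\<not> bad a"
proof
  assume "bad a"
  have ne: "v \<noteq> a" "v \<noteq> b" "v \<noteq> c" "v \<noteq> d" "a \<noteq> b" "a \<noteq> c" "a \<noteq> d" "b \<noteq> c" "b \<noteq> d" "c \<noteq> d"
    using t unfolding typeB_def by auto
  have F: "{v, a, b, c} \<in> F" "{v, a, d} \<in> F" "{v, b, d} \<in> F" "{v, c, d} \<in> F"
    using t by (simp_all add: typeB_def)
  have m: "X \<in> F" if "X \<subseteq> {v, a, b, c} \<or> X \<subseteq> {v, a, d} \<or> X \<subseteq> {v, b, d} \<or> X \<subseteq> {v, c, d}" for X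
    using that F down by metis
  have "{v, a, b, c} \<subseteq> nbrs d" using ne ne[symmetric] by (simp add: nbrs_def m)
  moreover have "card {v, a, b, c} = 4" using ne by simp
  ultimately have nd: "nbrs d = {v, a, b, c}" by (rule bad_nbrs_eq[OF assms(2)])
  have c0: "codegk d v 4 = 0" using codeg_typeB(6)[OF t] by (simp add: codegk_sym)
  have dabc: "{d, a, b, c} \<in> F \<and> card (S d 3) = 6"
    using assms(2)
  proof (cases rule: bad_cases)
    case (1 a' b' c' d')
    have "nbrs d = {a', b', c', d'}" using 1(1) by (simp only: typeA_def)
    with nd have "v \<in> {a', b', c', d'}" by blast
    moreover note codeg_typeA[OF 1(1)] codeg_typeA[OF typeA_swap(1)[OF typeA_swap(2)[OF 1(1)]]]
    ultimately show ?thesis using c0 by auto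
  next
    case (2 a' b' c' d')
    have "nbrs d = {a', b', c', d'}" using 2(1) by (simp only: typeB_def)
    with nd have e: "{a', b', c', d'} = {v, a, b, c}" by simp
    then have "v \<in> {a', b', c', d'}" by simp
    moreover note codeg_typeB(3)[OF 2(1)] codeg_typeB(3)[OF typeB_swap(1)[OF 2(1)]]
      codeg_typeB(3)[OF typeB_swap(2)[OF 2(1)]]
    ultimately have v: "v = d'" using c0 by auto
    have "d' \<notin> {a', b', c'}" using 2(1) by (auto simp: typeB_def)
    then have "{a', b', c'} = {a', b', c', d'} - {d'}" by auto
    also have "\<dots> = {v, a, b, c} - {v}" unfolding e v ..
    also have "\<dots> = {a, b, c}" using ne by auto
    finally have "{a', b', c'} = {a, b, c}" .
    moreover have "{d, a', b', c'} \<in> F" using 2(1) by (simp add: typeB_def)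
    ultimately show ?thesis using 2(2) by simp
  qed
  have "card (S d 2) = 4" using bad_profile[OF \<open>bad d\<close>] by simp
  note six = six_edges_mem[OF this conjunct2[OF dabc]]
  have dd: "{d, a, b} \<in> F" "{d, a, c} \<in> F" by (rule six; use ne nd in simp)+
  let ?L = "[{a,v,b}, {a,v,c}, {a,v,d}, {a,b,c}, {d,a,b}, {d,a,c}]"
  have "distinct ?L" using ne by (simp add: set_eq_subset)
  then have "card (set ?L) = 6" by (subst distinct_card) simp_all
  moreover have "set ?L \<subseteq> S a 3" using ne by (simp add: S_iff m dd)
  ultimately have "6 \<le> card (S a 3)" using card_mono[OF finite_S] by metis
  moreover have "card {{v,a,b,c}, {d,a,b,c}} = 2" using ne by (simp add: set_eq_subset)
  moreover have "{{v,a,b,c}, {d,a,b,c}} \<subseteq> S a 4" using ne ne[symmetric] dabc by (simp add: S_iff m)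
  ultimately have "6 \<le> card (S a 3)" "2 \<le> card (S a 4)" using card_mono[OF finite_S] by metis+
  then show False using bad_profile[OF \<open>bad a\<close>] by simp
qed

text \<open>Codegree 6 marks a hub, 5 a base vertex, and the remaining value 4 a rim vertex or a
  tip. The raised rate at six or more neighbours serves the case of two bad hubs, where the two rim
  vertices must cover the deficit 8.\<close>

definition pay :: "'a \<Rightarrow> 'a \<Rightarrow> nat" where
  "pay g v = (if bad v \<and> \<not> bad g \<and> v \<in> nbrs g
     then if codeg v g = 6 then 4 else if codeg v g = 5 then 1 else if 6 \<le> card (S g 2) then 4 else 3
     else 0)"

text \<open>Type A: two good hubs pay 4 + 4; with one bad hub the rim is good and at least 4 + 3 + 3
  arrives; with two bad hubs \<open>typeA_twins_rim\<close> makes the rim pay 4 + 4. Type B: a good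
  tip pays at least 3, and beside a bad tip the three base vertices are good and pay 1 each.\<close>

lemma bad_receives:
  assumes "bad v"
  shows "318 \<le> W v + (\<Sum>g\<in>V. pay g v)"
  using assms
proof (cases rule: bad_cases)
  case (1 a b c d)
  note t = 1(1) and t' = typeA_swap(1)[OF typeA_swap(2)[OF 1(1)]]
  have W: "W v = 310" using 1 bad_profile[OF assms] by (simp add: W_def)
  have nv: "nbrs v = {a, b, c, d}" and dist: "distinct [a, b, c, d]" using t by (auto simp: typeA_def)
  have nb: "v \<in> nbrs a" "v \<in> nbrs b" "v \<in> nbrs c" "v \<in> nbrs d" using nv nbrs_sym by blast+
  have "(\<Sum>g\<in>{a, b, c, d}. pay g v) \<le> (\<Sum>g\<in>V. pay g v)"
    using nv nbrs_sub finite_V by (intro sum_mono2) auto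
  then have sum: "pay a v + pay b v + pay c v + pay d v \<le> (\<Sum>g\<in>V. pay g v)"
    using dist by (simp add: add.assoc)
  have hub: "pay a v = (if bad a then 0 else 4)" "pay b v = (if bad b then 0 else 4)"
    using nb assms codeg_typeA(1)[OF t] codeg_typeA(1)[OF t'] by (simp_all add: pay_def)
  have rim: "\<not> bad c \<Longrightarrow> pay c v = (if 6 \<le> card (S c 2) then 4 else 3)"
    "\<not> bad d \<Longrightarrow> pay d v = (if 6 \<le> card (S d 2) then 4 else 3)"
    using nb assms codeg_typeA(4)[OF t] codeg_typeA(4)[OF t'] by (simp_all add: pay_def)
  have cd: "bad c \<or> bad d \<Longrightarrow> \<not> bad a \<and> \<not> bad b"
    using typeA_bad_rim[OF t] typeA_bad_rim[OF t'] typeA_bad_rim[OF typeA_swap(1)[OF t]]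
      typeA_bad_rim[OF typeA_swap(2)[OF t]] by blast
  have twins: "bad a \<Longrightarrow> bad b \<Longrightarrow> 6 \<le> card (S c 2) \<and> 6 \<le> card (S d 2)"
    using typeA_twins_rim[OF t] typeA_twins_rim[OF typeA_swap(2)[OF t]] by blast
  have "8 \<le> pay a v + pay b v + pay c v + pay d v"
  proof (cases "bad a \<or> bad b")
    case True
    then have "\<not> bad c" "\<not> bad d" using cd by auto
    then show ?thesis using True hub rim twins by (cases "bad a"; cases "bad b") auto
  next
    case False
    then show ?thesis using hub by simp
  qed
  then show ?thesis using W sum by simp
next
  case (2 a b c d)
  note t = 2(1) note tb = typeB_swap(1)[OF t] and tc = typeB_swap(2)[OF t]
  have W: "W v = 315" using 2 bad_profile[OF assms] by (simp add: W_def)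
  have nv: "nbrs v = {a, b, c, d}" and dist: "distinct [a, b, c, d]" using t by (auto simp: typeB_def)
  have nb: "v \<in> nbrs a" "v \<in> nbrs b" "v \<in> nbrs c" "v \<in> nbrs d" using nv nbrs_sym by blast+
  have "(\<Sum>g\<in>{a, b, c, d}. pay g v) \<le> (\<Sum>g\<in>V. pay g v)"
    using nv nbrs_sub finite_V by (intro sum_mono2) auto
  then have sum: "pay a v + pay b v + pay c v + pay d v \<le> (\<Sum>g\<in>V. pay g v)"
    using dist by (simp add: add.assoc)
  have "3 \<le> pay a v + pay b v + pay c v + pay d v"
  proof (cases "bad d")
    case True
    then have "\<not> bad a" "\<not> bad b" "\<not> bad c"
      using typeB_bad_tip[OF t] typeB_bad_tip[OF tb] typeB_bad_tip[OF tc] by auto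
    then have "pay a v = 1" "pay b v = 1" "pay c v = 1"
      using nb assms codeg_typeB(1)[OF t] codeg_typeB(1)[OF tb] codeg_typeB(1)[OF tc]
      by (simp_all add: pay_def)
    then show ?thesis by simp
  next
    case False
    then have "3 \<le> pay d v" using nb assms codeg_typeB(4)[OF t] by (simp add: pay_def)
    then show ?thesis by simp
  qed
  then show ?thesis using W sum by simp
qed

section \<open>What a vertex has to pay in total\<close>

lemma sum_codegk: "(\<Sum>v\<in>nbrs g. codegk v g (Suc k)) = k * card (S g (Suc k))"
proof -
  have "(\<Sum>v\<in>nbrs g. codegk v g (Suc k)) = (\<Sum>v\<in>nbrs g. card {A \<in> S g (Suc k). v \<in> A})"
    unfolding codegk_def S_def by (intro sum.cong refl arg_cong[of _ _ card]) auto
  also have "\<dots> = (\<Sum>A\<in>S g (Suc k). card {v \<in> nbrs g. v \<in> A})"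
    by (rule sum_card_filter[OF finite_nbrs finite_S])
  also have "\<dots> = (\<Sum>A\<in>S g (Suc k). k)"
  proof (rule sum.cong[OF refl])
    fix A assume A: "A \<in> S g (Suc k)"
    then have "{v \<in> nbrs g. v \<in> A} = A - {g}"
      using mem_sub_nbrs[of A g] not_nbrs_self[of g] by (auto simp: S_iff)
    then show "card {v \<in> nbrs g. v \<in> A} = k" using A by (simp add: S_iff)
  qed
  finally show ?thesis by simp
qed

lemma codegk_S: "codegk v g k = card {A \<in> S g k. v \<in> A}"
  unfolding codegk_def S_def by (rule arg_cong[of _ _ card]) auto

definition chargers :: "'a \<Rightarrow> 'a set" where
  "chargers g = {v \<in> nbrs g. bad v}"

lemma charger_codeg:
  assumes "v \<in> chargers g"
  shows "(codegk v g 3, codegk v g 4, codeg v g) \<in> {(2,1,4), (3,2,6), (3,0,4), (3,1,5)}"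
  using assms bad_codeg nbrs_sym by (auto simp: chargers_def)

lemma pay_noncharger: "v \<notin> chargers g \<Longrightarrow> pay g v = 0"
  by (auto simp: pay_def chargers_def)

lemma pay_le4: "pay g v \<le> 4"
  by (simp add: pay_def)

lemma sum_pay: "(\<Sum>v\<in>V. pay g v) = (\<Sum>v\<in>chargers g. pay g v)"
  using nbrs_sub finite_V by (intro sum.mono_neutral_right) (auto simp: chargers_def pay_def)

text \<open>For the second bound: each bad neighbour shares at least two triples with
  \<open>g\<close>, and each triple has two elements besides \<open>g\<close>.\<close>

lemma card_chargers_le:
  "card (chargers g) \<le> card (S g 2)" "card (chargers g) \<le> card (S g 3)"
proof -
  show "card (chargers g) \<le> card (S g 2)"
    unfolding card_nbrs[symmetric] using finite_nbrs by (intro card_mono) (auto simp: chargers_def)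
  have "2 * card (chargers g) = (\<Sum>v\<in>chargers g. 2)" by simp
  also have "\<dots> \<le> (\<Sum>v\<in>chargers g. codegk v g 3)"
  proof (rule sum_mono)
    fix v assume "v \<in> chargers g"
    from charger_codeg[OF this] show "2 \<le> codegk v g 3" by auto
  qed
  also have "\<dots> \<le> (\<Sum>v\<in>nbrs g. codegk v g 3)"
    using finite_nbrs by (intro sum_mono2) (auto simp: chargers_def)
  also have "\<dots> = 2 * card (S g 3)" using sum_codegk[of g 2] by simp
  finally show "card (chargers g) \<le> card (S g 3)" by simp
qed

lemma sum_pay_le: "(\<Sum>v\<in>V. pay g v) \<le> 4 * card (S g 2)" "(\<Sum>v\<in>V. pay g v) \<le> 4 * card (S g 3)"
proof -
  have "(\<Sum>v\<in>V. pay g v) \<le> card (chargers g) * 4"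
    unfolding sum_pay using sum_bounded_above[of "chargers g" "pay g" 4] pay_le4 by simp
  then show "(\<Sum>v\<in>V. pay g v) \<le> 4 * card (S g 2)" "(\<Sum>v\<in>V. pay g v) \<le> 4 * card (S g 3)"
    using card_chargers_le[of g] by linarith+
qed

text \<open>Without 4-sets through \<open>g\<close>, every bad neighbour has \<open>g\<close> as its
  tip and receives 3, exactly the number of triples it shares with \<open>g\<close>; these numbers
  sum to at most 2 * 6.\<close>

lemma sum_pay_5_6_0:
  assumes "card (S g 2) = 5" "card (S g 3) = 6" "card (S g 4) = 0"
  shows "(\<Sum>v\<in>V. pay g v) \<le> 12"
proof -
  have "S g 4 = {}" using assms(3) finite_S by simp
  then have "codegk v g 4 = 0" for v by (simp add: codegk_S)
  then have c: "codegk v g 3 = 3 \<and> codeg v g = 4" if "v \<in> chargers g" for v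
    using charger_codeg[OF that] by auto
  have "(\<Sum>v\<in>V. pay g v) \<le> (\<Sum>v\<in>chargers g. codegk v g 3)"
    unfolding sum_pay using c assms(1) by (intro sum_mono) (auto simp: pay_def)
  also have "\<dots> \<le> (\<Sum>v\<in>nbrs g. codegk v g 3)"
    using finite_nbrs by (intro sum_mono2) (auto simp: chargers_def)
  also have "\<dots> = 12" using sum_codegk[of g 2] assms(2) by simp
  finally show ?thesis .
qed

lemma S_avoid_sub:
  "{A \<in> S g (Suc k). v \<notin> A} \<subseteq> insert g ` {X. X \<subseteq> nbrs g - {v} \<and> card X = k}"
proof
  fix A assume A: "A \<in> {A \<in> S g (Suc k). v \<notin> A}"
  then have "A - {g} \<subseteq> nbrs g - {v}" using mem_sub_nbrs[of A g] by (auto simp: S_iff)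
  moreover have "card (A - {g}) = k" using A by (simp add: S_iff)
  moreover have "A = insert g (A - {g})" using A by (auto simp: S_iff)
  ultimately show "A \<in> insert g ` {X. X \<subseteq> nbrs g - {v} \<and> card X = k}" by blast
qed

lemma card_S_avoid_le:
  assumes "v \<in> nbrs g"
  shows "card {A \<in> S g (Suc k). v \<notin> A} \<le> (card (nbrs g) - 1) choose k"
proof -
  have "finite {X. X \<subseteq> nbrs g - {v} \<and> card X = k}" using finite_nbrs by simp
  then have "card {A \<in> S g (Suc k). v \<notin> A} \<le> card {X. X \<subseteq> nbrs g - {v} \<and> card X = k}"
    using S_avoid_sub by (rule surj_card_le)
  then show ?thesis using n_subsets[of "nbrs g - {v}" k] finite_nbrs assms by simp
qed

lemma card_S_split: "card (S g k) = codegk v g k + card {A \<in> S g k. v \<notin> A}"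
proof -
  have "S g k = {A \<in> S g k. v \<in> A} \<union> {A \<in> S g k. v \<notin> A}" by auto
  then have "card (S g k) = card ({A \<in> S g k. v \<in> A} \<union> {A \<in> S g k. v \<notin> A})" by simp
  also have "\<dots> = card {A \<in> S g k. v \<in> A} + card {A \<in> S g k. v \<notin> A}"
    using finite_S by (intro card_Un_disjoint) auto
  finally show ?thesis by (simp add: codegk_S)
qed

lemma codegk3_le: "codegk v g 3 \<le> card (nbrs g) - 1" if v: "v \<in> nbrs g"
proof -
  have "{A \<in> S g 3. v \<in> A} \<subseteq> (\<lambda>x. {g, v, x}) ` (nbrs g - {v})"
  proof
    fix A assume A: "A \<in> {A \<in> S g 3. v \<in> A}"
    have gv: "g \<noteq> v" using v by (auto simp: nbrs_def)
    then have "card (A - {g} - {v}) = 1" using A by (simp add: S_iff)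
    then obtain x where x: "A - {g} - {v} = {x}" by (auto simp: card_1_singleton_iff)
    then have Ae: "A = {g, v, x}" "x \<noteq> g" "x \<noteq> v" using A by (auto simp: S_iff)
    then have "x \<in> nbrs g" using mem_sub_nbrs[of A g] A by (auto simp: S_iff)
    then show "A \<in> (\<lambda>x. {g, v, x}) ` (nbrs g - {v})" using Ae by blast
  qed
  then have "codegk v g 3 \<le> card (nbrs g - {v})"
    unfolding codegk_S using finite_nbrs by (intro surj_card_le) auto
  then show ?thesis using v finite_nbrs by simp
qed

lemma sum_pay_4_6_2:
  assumes "card (S g 2) = 4" "card (S g 3) = 6" "card (S g 4) = 2"
  shows "(\<Sum>v\<in>V. pay g v) \<le> 12"
proof -
  have n: "card (nbrs g) = 4" using assms(1) by (simp add: card_nbrs)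
  \<comment> \<open>A linear inequality with equality for the codegrees (2,1), (3,2) and (3,1). The
    pair (3,0) is excluded, because at most one 4-set through \<open>g\<close> avoids
    \<open>v\<close>. The sum over four neighbours is 18 + 16 - 24 = 10.\<close>
  have pt: "pay g v + 2 * codegk v g 3 \<le> 3 * codegk v g 4 + 4" if v: "v \<in> nbrs g" for v
  proof -
    have d: "codegk v g 3 \<le> 3" using codegk3_le[OF v] n by simp
    have "card {A \<in> S g 4. v \<notin> A} \<le> 1" using card_S_avoid_le[OF v, of 3] n by simp
    then have t: "1 \<le> codegk v g 4" using card_S_split[of g 4 v] assms(3) by simp
    show ?thesis
    proof (cases "v \<in> chargers g")
      case True
      from charger_codeg[OF this] t assms(1) show ?thesis by (auto simp: pay_def)
    next
      case False
      then have "pay g v = 0" by (rule pay_noncharger)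
      then show ?thesis using d t by simp
    qed
  qed
  have "(\<Sum>v\<in>nbrs g. pay g v + 2 * codegk v g 3) \<le> (\<Sum>v\<in>nbrs g. 3 * codegk v g 4 + 4)"
    by (rule sum_mono[OF pt])
  then have "(\<Sum>v\<in>nbrs g. pay g v) \<le> 10"
    using sum_codegk[of g 2] sum_codegk[of g 3] assms n
    by (simp add: sum.distrib sum_distrib_left[symmetric])
  moreover have "(\<Sum>v\<in>chargers g. pay g v) \<le> (\<Sum>v\<in>nbrs g. pay g v)"
    using finite_nbrs by (intro sum_mono2) (auto simp: chargers_def)
  ultimately show ?thesis unfolding sum_pay by simp
qed

text \<open>Only the three other elements of the single 4-set \<open>P\<close> can be bad
  neighbours, each receiving at most 3, and one of them receives at most 1.\<close>

lemma sum_pay_5_5_1: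
  assumes "card (S g 2) = 5" "card (S g 3) = 5" "card (S g 4) = 1"
  shows "(\<Sum>v\<in>V. pay g v) \<le> 7"
proof -
  have n: "card (nbrs g) = 5" using assms(1) by (simp add: card_nbrs)
  obtain P where P: "S g 4 = {P}" using assms(3) by (auto simp: card_1_singleton_iff)
  then have PS: "P \<in> F" "g \<in> P" "card P = 4" by (auto simp: S_def)
  then have "card (P - {g}) = 3" by simp
  then obtain x y z where xyz: "P - {g} = {x, y, z}" "x \<noteq> y" "x \<noteq> z" "y \<noteq> z" by (rule card_3E)
  have Pe: "P = {g, x, y, z}" using PS(2) xyz(1) by auto
  have g: "g \<noteq> x" "g \<noteq> y" "g \<noteq> z" using xyz(1) by auto
  have sub: "{x, y, z} \<subseteq> nbrs g" using mem_sub_nbrs[OF PS(1,2)] xyz(1) by auto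
  let ?T = "{{g,x,y}, {g,x,z}, {g,y,z}}"
  have m: "X \<in> F" if "X \<subseteq> {g, x, y, z}" for X using that PS(1) Pe down by metis
  have T: "?T \<subseteq> S g 3" using g xyz(2-) by (simp add: S_iff m)
  have cT: "card ?T = 3" using g xyz(2-) by (simp add: card_insert_if set_eq_subset)
  \<comment> \<open>A bad neighbour outside \<open>P\<close> would share no 4-set and hence three
    triples with \<open>g\<close>, but three of the five triples lie inside
    \<open>P\<close>.\<close>
  have C: "chargers g \<subseteq> {x, y, z}"
  proof
    fix u assume u: "u \<in> chargers g"
    show "u \<in> {x, y, z}"
    proof (rule ccontr)
      assume nu: "u \<notin> {x, y, z}"
      have ug: "u \<noteq> g" using u not_nbrs_self by (auto simp: chargers_def)
      have "codegk u g 4 = 0" using P Pe nu ug by (simp add: codegk_S)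
      then have "codegk u g 3 = 3" using charger_codeg[OF u] by auto
      moreover have "?T \<subseteq> {A \<in> S g 3. u \<notin> A}" using T nu ug by auto
      then have "3 \<le> card {A \<in> S g 3. u \<notin> A}" using cT finite_S card_mono[of "{A \<in> S g 3. u \<notin> A}" ?T] by simp
      ultimately show False using card_S_split[of g 3 u] assms(2) by simp
    qed
  qed
  \<comment> \<open>Sharing exactly one 4-set leaves the codegrees (2,1,4), paid 3 as
    \<open>g\<close> has only five neighbours, and (3,1,5), paid 1.\<close>
  have pay3: "pay g u \<le> 3 \<and> (3 \<le> codegk u g 3 \<longrightarrow> pay g u \<le> 1)" if "u \<in> {x, y, z}" for u
  proof (cases "u \<in> chargers g")
    case True
    have "{A \<in> S g 4. u \<in> A} = {P}" using P Pe that by auto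
    then have "codegk u g 4 = 1" by (simp add: codegk_S)
    then show ?thesis using charger_codeg[OF True] assms(1) by (auto simp: pay_def)
  next
    case False
    then show ?thesis by (simp add: pay_noncharger)
  qed
  have two: "A \<in> {B, B'}"
    if "codegk u g 3 < 3" "B \<noteq> B'" "{B, B'} \<subseteq> {A \<in> S g 3. u \<in> A}" "A \<in> S g 3" "u \<in> A" for u A B B'
  proof (rule ccontr)
    assume "A \<notin> {B, B'}"
    then have "card {A, B, B'} = 3" using that(2) by simp
    moreover have "{A, B, B'} \<subseteq> {A \<in> S g 3. u \<in> A}" using that by simp
    ultimately have "3 \<le> codegk u g 3"
      unfolding codegk_S using card_mono[of "{A \<in> S g 3. u \<in> A}" "{A, B, B'}"] finite_S[of g 3] by simp
    then show False using that(1) by simp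
  qed
  have "\<exists>u\<in>{x, y, z}. 3 \<le> codegk u g 3"
  proof (rule ccontr)
    assume "\<not> ?thesis"
    then have lt: "codegk x g 3 < 3" "codegk y g 3 < 3" "codegk z g 3 < 3" by auto
    \<comment> \<open>If \<open>x\<close>, \<open>y\<close>, \<open>z\<close> share only two triples
      each with \<open>g\<close>, those are the ones inside \<open>P\<close>. Any other triple
      avoids all three, so it is \<open>g\<close> with the two remaining neighbours: four triples at
      most instead of five.\<close>
    let ?Q = "insert g (nbrs g - {x, y, z})"
    have cR: "card (nbrs g - {x, y, z}) = 2" using sub xyz(2-) n by (subst card_Diff_subset) auto
    then have cQ: "card ?Q = 3" using finite_nbrs not_nbrs_self by simp
    have ne: "{g,x,y} \<noteq> {g,x,z}" "{g,x,y} \<noteq> {g,y,z}" "{g,x,z} \<noteq> {g,y,z}"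
      using g xyz(2-) by (simp_all add: set_eq_subset)
    have "S g 3 \<subseteq> insert ?Q ?T"
    proof
      fix A assume A: "A \<in> S g 3"
      show "A \<in> insert ?Q ?T"
      proof (cases "x \<in> A \<or> y \<in> A \<or> z \<in> A")
        case True
        moreover have "A \<in> {{g,x,y}, {g,x,z}}" if "x \<in> A"
          by (rule two[OF lt(1) ne(1) _ A that]) (use T in simp)
        moreover have "A \<in> {{g,x,y}, {g,y,z}}" if "y \<in> A"
          by (rule two[OF lt(2) ne(2) _ A that]) (use T in simp)
        moreover have "A \<in> {{g,x,z}, {g,y,z}}" if "z \<in> A"
          by (rule two[OF lt(3) ne(3) _ A that]) (use T in simp)
        ultimately have "A \<in> ?T" by blast
        then show ?thesis by (rule insertI2)
      next
        case False
        then have "A \<subseteq> ?Q" using A mem_sub_nbrs[of A g] by (auto simp: S_iff)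
        moreover have "card A = card ?Q" using A cQ by (simp add: S_iff)
        ultimately have "A = ?Q" using finite_nbrs by (intro card_subset_eq) auto
        then show ?thesis by (rule ssubst) (rule insertI1)
      qed
    qed
    then have "card (S g 3) \<le> card (insert ?Q ?T)" by (intro card_mono) simp_all
    also have "\<dots> \<le> Suc (card ?T)" by (rule card_insert_le_m1) simp_all
    finally show False using cT assms(2) by simp
  qed
  then have "pay g x \<le> 1 \<or> pay g y \<le> 1 \<or> pay g z \<le> 1" using pay3 by blast
  moreover have "pay g x \<le> 3" "pay g y \<le> 3" "pay g z \<le> 3" using pay3 by blast+
  ultimately have "pay g x + pay g y + pay g z \<le> 7" by linarith
  moreover have "(\<Sum>v\<in>chargers g. pay g v) \<le> (\<Sum>v\<in>{x, y, z}. pay g v)"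
    using C by (intro sum_mono2) auto
  ultimately show ?thesis unfolding sum_pay using xyz(2-) by simp
qed

text \<open>With p, q, r sets of size 2, 3, 4 through \<open>g\<close>, the surplus is 30p + 20q +
  15r - 258. The crude bounds 4p and 4q on the payments suffice except for the profiles (5,6,0),
  (5,5,1) and (4,6,2), with surplus 12, 7 and 12, treated separately above.\<close>

lemma good_pays:
  assumes g: "g \<in> V" and ng: "\<not> bad g"
  shows "318 + (\<Sum>v\<in>V. pay g v) \<le> W g"
proof -
  have W: "W g = 60 + 30 * card (S g 2) + 20 * card (S g 3) + 15 * card (S g 4)" by (simp add: W_def)
  have W318: "318 \<le> W g" using g ng by (simp add: bad_def)
  note ge4 = S2_ge4[OF g] and size = profile_size[OF g] and le = sum_pay_le[of g]
  consider "6 \<le> card (S g 2)" | "card (S g 2) = 5" | "card (S g 2) = 4" using ge4 by linarith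
  then show ?thesis
  proof cases
    case 1
    consider "card (S g 4) = 0" | "card (S g 4) = 1" | "2 \<le> card (S g 4)" by linarith
    then show ?thesis
    proof cases
      assume "2 \<le> card (S g 4)"
      moreover from this have "5 \<le> card (S g 3)" by (rule S4_two)
      ultimately show ?thesis using 1 W le(2) by linarith
    qed (use 1 W le(2) size in linarith)+
  next
    case 2
    consider "card (S g 4) = 0" | "card (S g 4) = 1" | "2 \<le> card (S g 4)" by linarith
    then show ?thesis
    proof cases
      assume 4: "card (S g 4) = 0"
      show ?thesis
      proof (cases "card (S g 3) = 6")
        case True
        then show ?thesis using sum_pay_5_6_0[OF 2 True 4] W 2 by linarith
      next
        case False
        then show ?thesis using 2 4 W le(1) size by linarith
      qed
    next
      assume 4: "card (S g 4) = 1"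
      show ?thesis
      proof (cases "card (S g 3) = 5")
        case True
        then show ?thesis using sum_pay_5_5_1[OF 2 True 4] W 2 4 by linarith
      next
        case False
        then show ?thesis using 2 4 W le(1) size by linarith
      qed
    next
      assume "2 \<le> card (S g 4)"
      moreover from this have "5 \<le> card (S g 3)" by (rule S4_two)
      ultimately show ?thesis using 2 W le(1) by linarith
    qed
  next
    case 3
    note le6 = S3_le6[OF 3]
    consider "card (S g 4) \<le> 1" | "card (S g 4) = 2" | "3 \<le> card (S g 4)" by linarith
    then show ?thesis
    proof cases
      \<comment> \<open>The size bound leaves only the profile (4,6,1) of weight 315, contradicting
        \<open>W318\<close>.\<close>
      assume "card (S g 4) \<le> 1"
      then show ?thesis using 3 W W318 le6 size by linarith
    next
      assume 4: "card (S g 4) = 2"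
      then have "card (S g 3) = 6" using 3 W W318 le6 by linarith
      then show ?thesis using sum_pay_4_6_2[OF 3 _ 4] 3 4 W by linarith
    next
      assume 4: "3 \<le> card (S g 4)"
      then have "card (S g 3) \<noteq> 5" using five_edges(1)[OF 3] by linarith
      moreover have "5 \<le> card (S g 3)" using 4 S4_two[of g] by linarith
      ultimately show ?thesis using 3 4 W le(1) le6 by linarith
    qed
  qed
qed

section \<open>Summation over all vertices\<close>

lemma sum_W_le: "(\<Sum>v\<in>V. W v) \<le> 60 * (card F - 1)"
proof (cases "V = {}")
  case True
  then show ?thesis by simp
next
  case False
  let ?F = "\<lambda>k. {A \<in> F. card A = k}"
  have s: "(\<Sum>v\<in>V. card (S v k)) = k * card (?F k)" for k
  proof -
    have "(\<Sum>v\<in>V. card (S v k)) = (\<Sum>v\<in>V. card {A \<in> ?F k. v \<in> A})"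
      by (intro sum.cong refl arg_cong[of _ _ card]) (auto simp: S_def)
    also have "\<dots> = (\<Sum>A\<in>?F k. card {v \<in> V. v \<in> A})"
      using finite_V finite_F by (intro sum_card_filter) auto
    also have "\<dots> = (\<Sum>A\<in>?F k. k)"
    proof (rule sum.cong[OF refl])
      fix A assume A: "A \<in> ?F k"
      then have "{v \<in> V. v \<in> A} = A" using F_sub by auto
      then show "card {v \<in> V. v \<in> A} = k" using A by simp
    qed
    finally show ?thesis by simp
  qed
  have "(\<Sum>v\<in>V. W v) = (\<Sum>v\<in>V. 60 * card (S v 1) + 30 * card (S v 2) + 20 * card (S v 3) + 15 * card (S v 4))"
    using card_S1 by (intro sum.cong refl) (simp add: W_def)
  also have "\<dots> = 60 * (\<Sum>v\<in>V. card (S v 1)) + 30 * (\<Sum>v\<in>V. card (S v 2))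
      + 20 * (\<Sum>v\<in>V. card (S v 3)) + 15 * (\<Sum>v\<in>V. card (S v 4))"
    by (simp add: sum.distrib sum_distrib_left)
  \<comment> \<open>A set of size \<open>k\<close> hands out 60/k to each of its \<open>k\<close>
    elements, 60 altogether.\<close>
  also have "\<dots> = 60 * (\<Sum>k\<in>{1,2,3,4}. card (?F k))" unfolding s by simp
  also have "(\<Sum>k\<in>{1,2,3,4}. card (?F k)) = card (\<Union>k\<in>{1,2,3,4}. ?F k)"
    using finite_F by (intro card_UN_disjoint[symmetric]) auto
  also have "\<dots> \<le> card (F - {{}})" using finite_F by (intro card_mono) auto
  \<comment> \<open>The empty set hands out nothing; it belongs to \<open>F\<close> because
    \<open>V\<close> is nonempty here.\<close>
  also have "card (F - {{}}) = card F - 1"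
  proof -
    obtain v where "v \<in> V" using False by auto
    then have "{} \<in> F" using sing_mem down by blast
    then show ?thesis by simp
  qed
  finally show ?thesis by simp
qed

theorem card_lower_bound: "318 * card V \<le> 60 * (card F - 1)"
proof -
  \<comment> \<open>A bad vertex pays nothing, and a good one already covers its own payments.
    Summed over all vertices, paid and received amounts cancel.\<close>
  have "(\<Sum>v\<in>V. 318 + (\<Sum>u\<in>V. pay v u)) \<le> (\<Sum>v\<in>V. W v + (\<Sum>g\<in>V. pay g v))"
  proof (rule sum_mono)
    fix v assume v: "v \<in> V"
    show "318 + (\<Sum>u\<in>V. pay v u) \<le> W v + (\<Sum>g\<in>V. pay g v)"
    proof (cases "bad v")
      case True
      then have "pay v u = 0" for u by (simp add: pay_def)
      then show ?thesis using bad_receives[OF True] by simp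
    next
      case False
      then show ?thesis using good_pays[OF v] by simp
    qed
  qed
  then have "318 * card V + (\<Sum>v\<in>V. \<Sum>u\<in>V. pay v u) \<le> (\<Sum>v\<in>V. W v) + (\<Sum>v\<in>V. \<Sum>g\<in>V. pay g v)"
    by (simp add: sum.distrib)
  moreover have "(\<Sum>v\<in>V. \<Sum>g\<in>V. pay g v) = (\<Sum>v\<in>V. \<Sum>u\<in>V. pay v u)" by (rule sum.swap)
  ultimately show ?thesis using sum_W_le by linarith
qed

end

subsection \<open>Bounds on m(n,11)\<close>

text \<open>The bound for downsets divided by 6. The 10 comes from the empty set, and
  \<open>F \<noteq> {}\<close> keeps \<open>card F - 1\<close> from being truncated.\<close>

lemma lower_bound:
  assumes "finite V" "F \<subseteq> Pow V" "\<And>v. v \<in> V \<Longrightarrow> 12 \<le> loss F v" "F \<noteq> {}"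
  shows "53 * card V + 10 \<le> 10 * card F"
proof -
  obtain G where G: "G \<subseteq> Pow V" "card G = card F" "\<And>v. v \<in> V \<Longrightarrow> 12 \<le> loss G v"
    and down: "\<And>A B. A \<in> G \<Longrightarrow> B \<subseteq> A \<Longrightarrow> B \<in> G"
    using exists_downset[OF assms(1-3)] by blast
  interpret dense_downset V G
    using assms(1) G down by unfold_locales (auto simp: loss_downset[OF down])
  have "finite F" using assms(1,2) by (meson finite_Pow_iff finite_subset)
  then have "card F \<noteq> 0" using assms(4) by simp
  then show ?thesis using card_lower_bound G(2) by linarith
qed

text \<open>A subfamily \<open>G\<close> of exactly \<open>m\<close> sets suffices, as its traces
  lie in those of \<open>F\<close>. If every vertex had loss at least 12 in a nonempty
  \<open>G\<close>, \<open>lower_bound\<close> would give 53n + 10 \<le> 10m.\<close>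

lemma arrow_of_le:
  assumes "10 * m \<le> 53 * n"
  shows "arrow n m (n - 1) (m - 11)"
  unfolding arrow_def
proof (intro allI impI)
  fix V :: "nat set" and F assume V: "finite V \<and> card V = n" and F: "F \<subseteq> Pow V \<and> m \<le> card F"
  then have fF: "finite F" by (meson finite_Pow_iff finite_subset)
  obtain G where G: "G \<subseteq> F" "card G = m" using F obtain_subset_with_card_n by metis
  show "\<exists>T\<subseteq>V. card T = n - 1 \<and> m - 11 \<le> card (trace F T)"
  proof (cases "m = 0")
    case True
    obtain T where "T \<subseteq> V" "card T = n - 1" using V obtain_subset_with_card_n[of "n - 1" V] by auto
    then show ?thesis using True by auto
  next
    case False
    then have ne: "G \<noteq> {}" using G by auto
    have sub: "G \<subseteq> Pow V" using F G by auto
    have "\<not> (\<forall>v\<in>V. 12 \<le> loss G v)"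
      using lower_bound[of V G] V sub ne G(2) assms by auto
    then obtain v where v: "v \<in> V" "loss G v < 12" by auto
    have "trace G (V - {v}) \<subseteq> trace F (V - {v})" using G(1) by (auto simp: trace_def)
    then have "card (trace G (V - {v})) \<le> card (trace F (V - {v}))"
      using fF by (intro card_mono) (auto simp: trace_def)
    moreover have "card (trace G (V - {v})) + loss G v = m"
      using card_trace_remove[of V G v] V sub v(1) G(2) by simp
    ultimately have "m - 11 \<le> card (trace F (V - {v}))" using v(2) by linarith
    moreover have "card (V - {v}) = n - 1" using V v(1) by simp
    ultimately show ?thesis by blast
  qed
qed

section \<open>The extremal construction\<close>

definition block :: "nat list list" where
  "block = (let L = filter (\<lambda>xs. xs \<noteq> [] \<and> (length xs \<le> 3 \<or> xs = [0,1,2,3])) (subseqs [0,1,2,3,4])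
     in L @ map (map (\<lambda>x. x + 5)) L @ [[4, 9]])"

text \<open>Each half has 5 + 10 + 10 sets of size 1, 2, 3 and one 4-set, and the edge joins the
  halves: 2 * 26 + 1. The empty set is left out because all blocks share it.\<close>

lemma length_block: "length block = 53"
  by code_simp

text \<open>Every vertex lies in 1 + 4 + 6 = 11 sets of size at most 3 within its half, and in one
  more: the 4-set, or the edge for 4 and 9. Sorted lists make this checkable by evaluation.\<close>

lemma block_props:
  "list_all (\<lambda>xs. sorted xs \<and> distinct xs \<and> list_all (\<lambda>x. x < 10) xs) block"
  "distinct ([] # block)"
  "list_all (\<lambda>v. 12 \<le> length (filter (\<lambda>xs. v \<notin> set xs \<and> List.member block (insort v xs)) ([] # block))) [0,1,2,3,4,5,6,7,8,9]"
  by code_simp+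

text \<open>The set \<open>S\<close> holds the offsets of the translated blocks; translates may
  overlap.\<close>

definition block_family :: "nat set \<Rightarrow> nat set set" where
  "block_family S = insert {} (\<Union>s\<in>S. (\<lambda>xs. (\<lambda>x. x + s) ` set xs) ` set block)"

lemma card_block_family:
  assumes "finite S"
  shows "card (block_family S) \<le> 53 * card S + 1"
proof -
  have "card (\<Union>s\<in>S. (\<lambda>xs. (\<lambda>x. x + s) ` set xs) ` set block)
      \<le> (\<Sum>s\<in>S. card ((\<lambda>xs. (\<lambda>x. x + s) ` set xs) ` set block))"
    by (rule card_UN_le[OF assms])
  also have "\<dots> \<le> (\<Sum>s\<in>S. 53)"
  proof (rule sum_mono)
    fix s
    have "card ((\<lambda>xs. (\<lambda>x. x + s) ` set xs) ` set block) \<le> card (set block)"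
      by (rule card_image_le) simp
    also have "\<dots> \<le> 53" using card_length[of block] by (simp add: length_block)
    finally show "card ((\<lambda>xs. (\<lambda>x. x + s) ` set xs) ` set block) \<le> 53" .
  qed
  finally have "card (\<Union>s\<in>S. (\<lambda>xs. (\<lambda>x. x + s) ` set xs) ` set block) \<le> 53 * card S" by simp
  then show ?thesis unfolding block_family_def
    using card_insert_le_m1[of "53 * card S + 1" "\<Union>s\<in>S. (\<lambda>xs. (\<lambda>x. x + s) ` set xs) ` set block" "{}"]
    by simp
qed

lemma block_family_sub:
  assumes "\<And>s. s \<in> S \<Longrightarrow> s + 10 \<le> n"
  shows "block_family S \<subseteq> Pow {..<n}"
proof -
  have "x + s < n" if "s \<in> S" "xs \<in> set block" "x \<in> set xs" for s xs x
    using block_props(1) assms[OF that(1)] that(2,3) by (fastforce simp: list_all_iff)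
  then show ?thesis by (auto simp: block_family_def)
qed

lemma finite_block_family: "finite S \<Longrightarrow> finite (block_family S)"
  by (simp add: block_family_def)

text \<open>Only the translate by \<open>s\<close> is used. The twelve or more lists counted for
  \<open>w = v - s\<close> stay different as sets, because a sorted distinct list is determined by
  its elements.\<close>

lemma loss_block_family:
  assumes "finite S" "s \<in> S" "s \<le> v" "v < s + 10"
  shows "12 \<le> loss (block_family S) v"
proof -
  define w where "w = v - s"
  have v: "v = w + s" and "w < 10" using assms(3,4) by (auto simp: w_def)
  then have "w \<in> set [0,1,2,3,4,5,6,7,8,9]" by (simp add: numeral_eq_Suc less_Suc_eq)
  let ?L = "filter (\<lambda>xs. w \<notin> set xs \<and> List.member block (insort w xs)) ([] # block)"
  let ?f = "\<lambda>xs. (\<lambda>x. x + s) ` set xs"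
  have mem: "(zs = [] \<or> zs \<in> set block) \<and> w \<notin> set zs \<and> insort w zs \<in> set block"
    if "zs \<in> set ?L" for zs using that by (auto simp: List.member_iff split: if_splits)
  have "12 \<le> length ?L" using block_props(3) \<open>w \<in> set _\<close> unfolding list_all_iff by blast
  also have "length ?L = card (set ?L)"
    using block_props(2) by (intro distinct_card[symmetric] distinct_filter)
  also have "\<dots> = card (?f ` set ?L)"
  proof (rule card_image[symmetric], rule inj_onI)
    fix xs ys assume m: "xs \<in> set ?L" "ys \<in> set ?L" and e: "?f xs = ?f ys"
    have "inj (\<lambda>x. x + s)" by simp
    then have "set xs = set ys" using e by (simp only: inj_image_eq_iff)
    moreover have "sorted zs \<and> distinct zs" if "zs \<in> set ?L" for zs
    proof -
      have "zs = [] \<or> zs \<in> set block" using mem[OF that] by blast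
      then show ?thesis using block_props(1) by (auto simp: list_all_iff)
    qed
    ultimately show "xs = ys" using m sorted_distinct_set_unique by blast
  qed
  also have "\<dots> \<le> loss (block_family S) v"
    unfolding loss_def
  proof (rule card_mono)
    show "finite {B \<in> block_family S. v \<notin> B \<and> insert v B \<in> block_family S}"
      using finite_block_family[OF assms(1)] by simp
    show "?f ` set ?L \<subseteq> {B \<in> block_family S. v \<notin> B \<and> insert v B \<in> block_family S}"
    proof
      fix B assume "B \<in> ?f ` set ?L"
      then obtain xs where "xs \<in> set ?L" and B: "B = ?f xs" by (rule imageE)
      from mem[OF this(1)] B have xs: "xs = [] \<or> xs \<in> set block" "w \<notin> set xs"
        "insort w xs \<in> set block" "B = ?f xs" by blast+
      have "insert v B = ?f (insort w xs)" using xs(4) v by (simp add: set_insort_key)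
      then have "insert v B \<in> block_family S" using xs(3) assms(2) unfolding block_family_def by blast
      moreover have "B \<in> block_family S" using xs(1,4) assms(2) unfolding block_family_def by auto
      moreover have "v \<notin> B" using xs(2,4) v by auto
      ultimately show "B \<in> {B \<in> block_family S. v \<notin> B \<and> insert v B \<in> block_family S}" by blast
    qed
  qed
  finally show ?thesis .
qed

lemma loss_mono:
  assumes "G \<subseteq> F" "finite F"
  shows "loss G v \<le> loss F v"
  unfolding loss_def using assms by (intro card_mono) auto

text \<open>The block family has at most \<open>m\<close> sets and is enlarged to exactly
  \<open>m\<close>. Losses do not decrease, so deleting any vertex leaves at most m - 12
  sets.\<close>

lemma not_arrow:
  assumes n: "n > 0" and S: "finite S" "\<And>s. s \<in> S \<Longrightarrow> s + 10 \<le> n"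
    and cover: "\<And>v. v < n \<Longrightarrow> \<exists>s\<in>S. s \<le> v \<and> v < s + 10"
    and m: "53 * card S < m" "m \<le> 2 ^ n"
  shows "\<not> arrow n m (n - 1) (m - 11)"
proof
  assume a: "arrow n m (n - 1) (m - 11)"
  let ?G = "block_family S" and ?V = "{..<n}"
  have "card ?G \<le> m" using card_block_family[OF S(1)] m(1) by linarith
  moreover have "m \<le> card (Pow ?V)" using m(2) by (simp add: card_Pow)
  ultimately obtain F where F: "?G \<subseteq> F" "F \<subseteq> Pow ?V" "card F = m"
    using exists_subset_between[of ?G m "Pow ?V"] block_family_sub[of S n] S(2) by auto
  have fF: "finite F" using F(2) finite_subset by auto
  obtain T where T: "T \<subseteq> ?V" "card T = n - 1" "m - 11 \<le> card (trace F T)"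
    using a F unfolding arrow_def by (metis card_lessThan finite_lessThan order_refl)
  have "card (?V - T) = 1" using T n by (subst card_Diff_subset) (auto intro: finite_subset)
  then obtain v where "?V - T = {v}" by (auto simp: card_1_singleton_iff)
  then have v: "v < n" "T = ?V - {v}" using T(1) by auto
  obtain s where "s \<in> S" "s \<le> v" "v < s + 10" using cover[OF v(1)] by blast
  then have "12 \<le> loss ?G v" by (rule loss_block_family[OF S(1)])
  also have "\<dots> \<le> loss F v" by (rule loss_mono[OF F(1) fF])
  finally have "12 \<le> loss F v" .
  moreover have "card (trace F T) + loss F v = m"
    using card_trace_remove[of ?V F v] F v by simp
  ultimately show False using T(3) by linarith
qed

section \<open>Values and asymptotics of m(n,11)\<close>

lemma mns_ge:
  assumes "10 * m \<le> 53 * n" "m \<le> 2 ^ n"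
  shows "m \<le> mns n 11"
  unfolding mns_def using assms arrow_of_le by (intro Max_ge) auto

lemma mns_le:
  assumes "n > 0" "finite S" "\<And>s. s \<in> S \<Longrightarrow> s + 10 \<le> n"
    "\<And>v. v < n \<Longrightarrow> \<exists>s\<in>S. s \<le> v \<and> v < s + 10"
  shows "mns n 11 \<le> 53 * card S"
proof -
  let ?M = "{m. m \<le> 2 ^ n \<and> arrow n m (n - 1) (m - 11)}"
  have "0 \<in> ?M" using arrow_of_le[of 0 n] by simp
  moreover have "finite ?M" by simp
  ultimately have "Max ?M \<in> ?M" using Max_in by blast
  then show ?thesis using not_arrow[OF assms, of "Max ?M"] unfolding mns_def by fastforce
qed

text \<open>Places the candidate value 5.3 n inside the range up to \<open>2 ^ n\<close> over which
  \<open>mns\<close> takes the maximum.\<close>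

lemma exp_ge: "5 \<le> n \<Longrightarrow> 53 * n \<le> 10 * 2 ^ n" for n :: nat
  by (induction n rule: dec_induct) auto

lemma mns_multiple:
  assumes "n > 0" "10 dvd n"
  shows "10 * mns n 11 = 53 * n"
proof -
  obtain k where k: "n = 10 * k" using assms(2) by blast
  \<comment> \<open>Disjoint consecutive blocks, \<open>k\<close> of them, tile the ground
    set.\<close>
  let ?S = "(\<lambda>i. 10 * i) ` {..<k}"
  have "mns n 11 \<le> 53 * card ?S"
  proof (rule mns_le[OF assms(1)])
    fix v assume "v < n"
    then have "v div 10 < k" using k by (simp add: less_mult_imp_div_less mult.commute)
    then show "\<exists>s\<in>?S. s \<le> v \<and> v < s + 10" by (intro bexI[of _ "10 * (v div 10)"]) auto
  qed (use k in auto)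
  also have "card ?S = k" by (subst card_image) (auto simp: inj_on_def)
  finally have "mns n 11 \<le> 53 * k" .
  moreover have "53 * k \<le> mns n 11"
    using exp_ge[of n] k assms(1) by (intro mns_ge) auto
  ultimately show ?thesis using k by simp
qed

lemma mns_bounds:
  assumes "10 \<le> n"
  shows "53 * n \<le> 10 * mns n 11 + 10" "10 * mns n 11 \<le> 53 * n + 530"
proof -
  have "53 * n div 10 \<le> 2 ^ n" using exp_ge[of n] assms by linarith
  then have "53 * n div 10 \<le> mns n 11" by (intro mns_ge) auto
  then show "53 * n \<le> 10 * mns n 11 + 10" by linarith
  \<comment> \<open>One extra block at the end, possibly overlapping the others, covers the last
    vertices when 10 does not divide \<open>n\<close>; it costs at most 53 sets.\<close>
  let ?S = "insert (n - 10) ((\<lambda>i. 10 * i) ` {..<n div 10})"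
  have "mns n 11 \<le> 53 * card ?S"
  proof (rule mns_le)
    fix v assume v: "v < n"
    show "\<exists>s\<in>?S. s \<le> v \<and> v < s + 10"
    proof (cases "v < n - 10")
      case True
      then have "v div 10 < n div 10" by linarith
      then show ?thesis by (intro bexI[of _ "10 * (v div 10)"]) auto
    next
      case False
      then show ?thesis using v by auto
    qed
  next
    fix s assume "s \<in> ?S"
    then consider "s = n - 10" | i where "s = 10 * i" "i < n div 10" by auto
    then show "s + 10 \<le> n"
    proof cases
      case 2
      then have "10 * Suc i \<le> 10 * (n div 10)" by (intro mult_le_mono2) simp
      then show ?thesis using 2(1) by simp
    qed (use assms in simp)
  qed (use assms in auto)
  also have "card ?S \<le> Suc (n div 10)"
    using card_image_le[of "{..<n div 10}" "\<lambda>i. 10 * i"]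
    by (intro card_insert_le_m1) auto
  finally show "10 * mns n 11 \<le> 53 * n + 530" by simp
qed

theorem mainTheorem1:
  shows "(\<forall>n::nat. n > 0 \<and> 10 dvd n \<longrightarrow>
            mns n 11 = mns n (2 ^ (5 - 1) - 5) \<and>
            real (mns n (2 ^ (5 - 1) - 5)) = ((2 ^ 5 - 5 - 1 / 2) / 5) * real n \<and>
            real (mns n 11) = 5.3 * real n)
         \<and> (\<lambda>n. real (mns n 11) / real n) \<longlonglongrightarrow> 5.3"
proof (intro conjI allI impI)
  fix n :: nat assume n: "n > 0 \<and> 10 dvd n"
  have s: "2 ^ (5 - 1) - 5 = (11 :: nat)" by simp
  have "10 * mns n 11 = 53 * n" using n by (intro mns_multiple) auto
  then have "real (10 * mns n 11) = real (53 * n)" by simp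
  then have e: "10 * real (mns n 11) = 53 * real n" by simp
  show "mns n 11 = mns n (2 ^ (5 - 1) - 5)" unfolding s ..
  show "real (mns n (2 ^ (5 - 1) - 5)) = ((2 ^ 5 - 5 - 1 / 2) / 5) * real n"
    unfolding s using e by simp
  show "real (mns n 11) = 5.3 * real n" using e by simp
next
  \<comment> \<open>Dividing \<open>mns_bounds\<close> by 10n puts the ratio between 5.3 - 1/n and
    5.3 + 53/n from n = 10 on.\<close>
  have lo: "(\<lambda>n. 5.3 - 1 / real n) \<longlonglongrightarrow> 5.3 - 0" 
    by (intro tendsto_diff tendsto_const lim_1_over_n)
  have "(\<lambda>n. 5.3 + 53 * (1 / real n)) \<longlonglongrightarrow> 5.3 + 53 * 0"
    by (intro tendsto_add tendsto_mult tendsto_const lim_1_over_n)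
  then have hi: "(\<lambda>n. 5.3 + 53 * (1 / real n)) \<longlonglongrightarrow> 5.3" by simp
  show "(\<lambda>n. real (mns n 11) / real n) \<longlonglongrightarrow> 5.3"
  proof (rule real_tendsto_sandwich[OF _ _ _ hi])
    show "(\<lambda>n. 5.3 - 1 / real n) \<longlonglongrightarrow> 5.3" using lo by simp
    show "\<forall>\<^sub>F n in sequentially. 5.3 - 1 / real n \<le> real (mns n 11) / real n"
    proof (rule eventually_sequentiallyI)
      fix n :: nat assume n: "10 \<le> n"
      have "real (53 * n) \<le> real (10 * mns n 11 + 10)"
        using mns_bounds(1)[OF n] by (rule of_nat_mono)
      then have "5.3 * real n - 1 \<le> real (mns n 11)" by simp
      then have "(5.3 * real n - 1) / real n \<le> real (mns n 11) / real n" by (rule divide_right_mono) simp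
      then show "5.3 - 1 / real n \<le> real (mns n 11) / real n" using n by (simp add: diff_divide_distrib)
    qed
    show "\<forall>\<^sub>F n in sequentially. real (mns n 11) / real n \<le> 5.3 + 53 * (1 / real n)"
    proof (rule eventually_sequentiallyI)
      fix n :: nat assume n: "10 \<le> n"
      have "real (10 * mns n 11) \<le> real (53 * n + 530)"
        using mns_bounds(2)[OF n] by (rule of_nat_mono)
      then have "real (mns n 11) \<le> 5.3 * real n + 53" by simp
      then have "real (mns n 11) / real n \<le> (5.3 * real n + 53) / real n" by (rule divide_right_mono) simp
      then show "real (mns n 11) / real n \<le> 5.3 + 53 * (1 / real n)" using n by (simp add: add_divide_distrib)
    qed
  qed
qed

end
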